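(* Let $F$ be a differential field of characteristic $0$ with derivation $D$, and let $C=\{a\in F : Da=0\}$ be its field of constants. Assume $C$ is algebraically closed. Let $R=F[x_1,\dots,x_n]$ be a differential domain over $F$ (finitely generated as an $F$-algebra), with quotient field $E$. If $R$ has only finitely many height one differential prime ideals, then $E$ has no new constants of differentiation, i.e. $\{e\in E : De=0\}=C$.
   Context: All rings are commutative with $1$. A differential ring is a ring with a single derivation $D$ (an additive map satisfying the Leibniz rule). A differential domain over a differential field $F$ is an integral domain containing $F$, equipped with a derivation extending that of $F$. The derivation on a domain $R$ extends uniquely to its quotient field $E$ by the quotient rule. The elements $x_1,\dots,x_n$ generate $R$ as an $F$-algebra and need not be algebraically independent. A differential ideal is an ideal $I$ with $D(I)\subseteq I$; a differential prime ideal is a prime ideal that is a differential ideal. *)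

theory Defs
  imports "HOL-Algebra.Algebra" "HOL-Library.Extended_Nat"
begin

locale differential_ring = cring R for R (structure) +
  fixes D :: "'a \<Rightarrow> 'a"
  assumes D_closed: "a \<in> carrier R \<Longrightarrow> D a \<in> carrier R"
    and D_add: "\<lbrakk>a \<in> carrier R; b \<in> carrier R\<rbrakk> \<Longrightarrow> D (a \<oplus> b) = D a \<oplus> D b"
    and D_mult: "\<lbrakk>a \<in> carrier R; b \<in> carrier R\<rbrakk> \<Longrightarrow> D (a \<otimes> b) = a \<otimes> D b \<oplus> D a \<otimes> b"

definition constants :: "('a, 'm) ring_scheme \<Rightarrow> ('a \<Rightarrow> 'a) \<Rightarrow> 'a set"
  where "constants R D = {a \<in> carrier R. D a = \<zero>\<^bsub>R\<^esub>}"

definition differential_prime_ideal ::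
    "'a set \<Rightarrow> ('a, 'm) ring_scheme \<Rightarrow> ('a \<Rightarrow> 'a) \<Rightarrow> bool"
  where "differential_prime_ideal P R D \<longleftrightarrow> primeideal P R \<and> D ` P \<subseteq> P"

(* The supremum of the lengths n of chains Q 0 < ... < Q n = P of prime ideals. The ideals
   Q 0, ..., Q (n - 1) are arbitrary primes, not assumed to be differential. *)
definition prime_height :: "('a, 'm) ring_scheme \<Rightarrow> 'a set \<Rightarrow> enat"
  where "prime_height R P =
    Sup {enat n | n. \<exists>Q :: nat \<Rightarrow> 'a set.
           (\<forall>i\<le>n. primeideal (Q i) R) \<and> (\<forall>i<n. Q i \<subset> Q (Suc i)) \<and> Q n = P}"

definition char_zero :: "('a, 'm) ring_scheme \<Rightarrow> bool"
  where "char_zero R \<longleftrightarrow> (\<forall>n::nat. n > 0 \<longrightarrow> [n] \<cdot>\<^bsub>R\<^esub> \<one>\<^bsub>R\<^esub> \<noteq> \<zero>\<^bsub>R\<^esub>)"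

(* The field E is the quotient field of its subring R. *)
definition quotient_field_of :: "('a, 'm) ring_scheme \<Rightarrow> 'a set \<Rightarrow> bool"
  where "quotient_field_of E R \<longleftrightarrow> field E \<and> subring R E \<and>
    (\<forall>e\<in>carrier E. \<exists>a\<in>R. \<exists>b\<in>R - {\<zero>\<^bsub>E\<^esub>}. e = a \<otimes>\<^bsub>E\<^esub> inv\<^bsub>E\<^esub> b)"

end

theory Submission
  imports Defs
begin

text \<open>
  Suppose \<open>c\<close> is a constant of \<open>E\<close> outside \<open>C\<close>. Applying \<open>D\<close> to the minimal polynomial of an
  algebraic constant shows that its coefficients are constants; since \<open>C\<close> is algebraically closed,
  \<open>c\<close> is transcendental over \<open>F\<close>. Write \<open>c = f / g\<close> with \<open>f, g \<in> R\<close>. For almost every natural number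
  \<open>\<alpha>\<close>, regarded as an element of \<open>C\<close>, the fibre \<open>c = \<alpha>\<close> carries a height one differential prime:
  a prime \<open>Q\<close> of \<open>R\<close> that contains \<open>f - \<alpha> g = (c - \<alpha>) g\<close> but not \<open>g\<close>. Different \<open>\<alpha>\<close> give different
  primes, because a prime containing \<open>f - \<alpha> g\<close> and \<open>f - \<beta> g\<close> contains \<open>(\<alpha> - \<beta>) g\<close>, hence \<open>g\<close>. This
  contradicts the finiteness hypothesis.

  Krull's principal ideal theorem and Noether normalization are avoided by cutting down to relative
  dimension one. By Zorn's lemma there is a subring \<open>A\<close> with \<open>F \<subseteq> A \<subseteq> R\<close> that is maximal among those over
  which \<open>c\<close> is transcendental. By the exchange property all of \<open>E\<close> is algebraic over \<open>A[c]\<close>, and also over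
  \<open>A[u]\<close> for each \<open>u \<in> R - A\<close> (\<open>algebraic_over_maximal_subring\<close>). Hence for a prime \<open>Q\<close> with
  \<open>Q \<inter> A = 0\<close> no prime lies strictly between \<open>0\<close> and \<open>Q\<close>: from \<open>0 \<noteq> u \<in> q\<close> and \<open>y \<in> Q - q\<close>, a
  polynomial relation between \<open>u\<close> and \<open>y\<close> over \<open>A\<close>, divided by the highest possible power of \<open>u\<close>,
  reduces modulo \<open>q\<close> to a nontrivial relation for \<open>y\<close>, and its lowest nonzero coefficient lies in \<open>Q\<close>
  (\<open>prime_below_disjoint_ideal\<close>).

  A prime \<open>Q\<close> containing \<open>(c - \<alpha>) g\<close> and avoiding the products \<open>a g\<^sup>k\<close> with \<open>0 \<noteq> a \<in> A\<close> exists unless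
  \<open>c - \<alpha>\<close> divides some \<open>a g\<^sup>k\<close> in \<open>R[c]\<close>. Such a divisibility descends to \<open>A[c]\<close> at the price of
  replacing \<open>g\<close> by one fixed nonzero \<open>h(c) \<in> A[c]\<close> (\<open>divisibility_descent\<close>), and there it forces
  \<open>h(\<alpha>) = 0\<close>, which excludes only finitely many \<open>\<alpha>\<close>.

  Finally, the elements of \<open>Q\<close> all of whose derivatives stay in \<open>Q\<close> form a prime ideal in
  characteristic zero (\<open>differential_core_prime\<close>). It contains \<open>R \<inter> (c - \<alpha>) R\<close>, which is stable under
  \<open>D\<close> because \<open>c - \<alpha>\<close> is a constant, so it is not zero. As there is no prime strictly between \<open>0\<close>
  and \<open>Q\<close>, it equals \<open>Q\<close>, and therefore \<open>Q\<close> is differential.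
\<close>

section \<open>Algebraic elements over a subring of a field\<close>

context field
begin

lemma eval_in_subring:
  assumes "subring B R" "set p \<subseteq> B" "x \<in> B"
  shows "eval p x \<in> B"
proof -
  interpret B: ring "R\<lparr>carrier := B\<rparr>" by (rule subring_is_ring[OF assms(1)])
  show ?thesis using B.eval_in_carrier[of p x] assms by (simp add: eval_consistent)
qed

lemma eval_map_mult:
  assumes "set p \<subseteq> carrier R" "d \<in> carrier R" "x \<in> carrier R"
  shows "eval (map ((\<otimes>) d) p) x = d \<otimes> eval p x"
  using assms(1)
proof (induct p)
  case (Cons a p)
  then show ?case using assms(2,3) by (simp add: eval_in_carrier r_distr m_assoc)
qed (use assms in simp)

lemma eval_zero_list:
  assumes "set p \<subseteq> {\<zero>}" "x \<in> carrier R" shows "eval p x = \<zero>"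
  using assms by (induct p) auto

text \<open>
  Arbitrary coefficient lists, with leading zeros permitted, are closed under the coefficientwise
  operations used below, in contrast to normalized polynomials.
\<close>
lemma mem_simple_extension_iff:
  assumes "subring A R" "x \<in> carrier R"
  shows "s \<in> simple_extension A x \<longleftrightarrow> (\<exists>q. set q \<subseteq> A \<and> s = eval q x)"
proof
  assume "s \<in> simple_extension A x"
  then obtain p where "p \<in> carrier (A[X])" "s = eval p x"
    using simple_extension_as_eval_img[OF subringE(1)[OF assms(1)] assms(2)] by auto
  then show "\<exists>q. set q \<subseteq> A \<and> s = eval q x"
    using polynomial_incl univ_poly_carrier by blast
next
  assume "\<exists>q. set q \<subseteq> A \<and> s = eval q x"
  then obtain q where "set q \<subseteq> A" "s = eval q x" by blast
  moreover have "set q \<subseteq> A \<Longrightarrow> eval q x \<in> simple_extension A x"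
    using eval_in_subring[OF simple_extension_is_subring[OF assms]]
      simple_extension_incl[OF subringE(1)[OF assms(1)] assms(2)]
      simple_extension_mem[OF assms] by blast
  ultimately show "s \<in> simple_extension A x" by blast
qed

lemma algebraic_iff_relation:
  assumes "subring A R" "x \<in> carrier R"
  shows "(algebraic over A) x \<longleftrightarrow> (\<exists>p. set p \<subseteq> A \<and> \<not> set p \<subseteq> {\<zero>} \<and> eval p x = \<zero>)"
proof
  assume "(algebraic over A) x"
  then obtain p where p: "p \<in> carrier (A[X])" "p \<noteq> []" "eval p x = \<zero>"
    using algebraicE[OF assms] by blast
  then have "polynomial A p" using univ_poly_carrier by blast
  then show "\<exists>p. set p \<subseteq> A \<and> \<not> set p \<subseteq> {\<zero>} \<and> eval p x = \<zero>"
    using p hd_in_set[OF p(2)] unfolding polynomial_def by blast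
next
  assume "\<exists>p. set p \<subseteq> A \<and> \<not> set p \<subseteq> {\<zero>} \<and> eval p x = \<zero>"
  then obtain p where p: "set p \<subseteq> A" "\<not> set p \<subseteq> {\<zero>}" "eval p x = \<zero>" by blast
  have "eval (normalize p) x = \<zero>"
    using eval_normalize[of p x] p subringE(1)[OF assms(1)] assms(2) by auto
  moreover have "normalize p \<in> carrier (A[X])"
    using normalize_gives_polynomial[OF p(1)] univ_poly_carrier by blast
  moreover have "normalize p \<noteq> []"
  proof
    assume n: "normalize p = []"
    have "p = replicate (length p - length (normalize p)) \<zero> @ normalize p"
      using normalize_def'[of p] by (metis fst_conv snd_conv)
    then have "set p \<subseteq> set (replicate (length p) \<zero>)" using n by simp
    then show False using p(2) by (auto split: if_splits)
  qed
  ultimately show "(algebraic over A) x" using algebraicI by blast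
qed

lemma transcendentalD:
  assumes "subring A R" "x \<in> carrier R" "(transcendental over A) x" "set p \<subseteq> A" "eval p x = \<zero>"
  shows "set p \<subseteq> {\<zero>}"
  using algebraic_iff_relation[OF assms(1,2)] assms(3-5) unfolding over_def by blast

definition fractions :: "'a set \<Rightarrow> 'a set"
  where "fractions A = {a \<otimes> inv b | a b. a \<in> A \<and> b \<in> A - {\<zero>}}"

lemma subset_fractions:
  assumes "subring A R" shows "A \<subseteq> fractions A"
proof
  fix a assume "a \<in> A"
  then have "a = a \<otimes> inv \<one>" using subringE(1)[OF assms] by auto
  then show "a \<in> fractions A"
    using \<open>a \<in> A\<close> subringE(3)[OF assms] one_not_zero unfolding fractions_def by blast
qed

lemma fractionsE:
  assumes "subring A R" "x \<in> fractions A"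
  obtains a b where "a \<in> A" "b \<in> A" "b \<noteq> \<zero>" "x \<in> carrier R" "b \<otimes> x = a"
proof -
  obtain a b where ab: "a \<in> A" "b \<in> A" "b \<noteq> \<zero>" "x = a \<otimes> inv b"
    using assms(2) unfolding fractions_def by auto
  have c: "a \<in> carrier R" "b \<in> carrier R - {\<zero>}" using ab subringE(1)[OF assms(1)] by auto
  have i: "inv b \<in> carrier R" "b \<otimes> inv b = \<one>"
    using subfield_m_inv[OF carrier_is_subfield c(2)] by auto
  have "b \<otimes> x = a \<otimes> (b \<otimes> inv b)" using c i(1) ab(4) by (simp add: m_lcomm)
  then show ?thesis using that ab c i by simp
qed

lemma fractionsI:
  assumes "subring A R" "a \<in> A" "b \<in> A" "b \<noteq> \<zero>" "x \<in> carrier R" "b \<otimes> x = a"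
  shows "x \<in> fractions A"
proof -
  have c: "a \<in> carrier R" "b \<in> carrier R - {\<zero>}" using assms subringE(1)[OF assms(1)] by auto
  have i: "inv b \<in> carrier R" "b \<otimes> inv b = \<one>"
    using subfield_m_inv[OF carrier_is_subfield c(2)] by auto
  have "a \<otimes> inv b = x \<otimes> (b \<otimes> inv b)" using c i(1) assms(5) unfolding assms(6)[symmetric] by (simp add: m_ac)
  then have "x = a \<otimes> inv b" using assms(5) i(2) by simp
  then show ?thesis using assms(2-4) unfolding fractions_def by auto
qed

lemma fractions_subfield:
  assumes "subring A R" shows "subfield (fractions A) R"
proof (rule subfieldI')
  note A = subringE[OF assms]
  have car: "a \<in> carrier R" if "a \<in> A" for a using that A(1) by blast
  show "subring (fractions A) R"
  proof (rule subringI)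
    show "fractions A \<subseteq> carrier R" using fractionsE[OF assms] by blast
    show "\<one> \<in> fractions A" using subset_fractions[OF assms] A(3) by blast
  next
    fix x assume "x \<in> fractions A"
    then obtain a b where ab: "a \<in> A" "b \<in> A" "b \<noteq> \<zero>" "x \<in> carrier R" "b \<otimes> x = a"
      using fractionsE[OF assms] by metis
    show "\<ominus> x \<in> fractions A"
      by (rule fractionsI[OF assms A(5)[OF ab(1)] ab(2,3)]) (use ab car in \<open>auto simp: r_minus\<close>)
  next
    fix x y assume "x \<in> fractions A" "y \<in> fractions A"
    then obtain a b a' b' where ab: "a \<in> A" "b \<in> A" "b \<noteq> \<zero>" "x \<in> carrier R" "b \<otimes> x = a"
      "a' \<in> A" "b' \<in> A" "b' \<noteq> \<zero>" "y \<in> carrier R" "b' \<otimes> y = a'"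
      using fractionsE[OF assms] by metis
    have bb: "b \<otimes> b' \<in> A" "b \<otimes> b' \<noteq> \<zero>" using ab A(6) car integral_iff by auto
    have "b \<otimes> b' \<otimes> (x \<otimes> y) = a \<otimes> a'"
      using ab(4,9) car[OF ab(2)] car[OF ab(7)] unfolding ab(5)[symmetric] ab(10)[symmetric]
      by algebra
    then show "x \<otimes> y \<in> fractions A"
      using fractionsI[OF assms A(6)[OF ab(1,6)] bb] ab by simp
    have "b \<otimes> b' \<otimes> (x \<oplus> y) = b' \<otimes> a \<oplus> b \<otimes> a'"
      using ab(4,9) car[OF ab(2)] car[OF ab(7)] unfolding ab(5)[symmetric] ab(10)[symmetric]
      by algebra
    moreover have "b' \<otimes> a \<oplus> b \<otimes> a' \<in> A" using ab A by auto
    ultimately show "x \<oplus> y \<in> fractions A"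
      using fractionsI[OF assms _ bb] ab by simp
  qed
  fix x assume x: "x \<in> fractions A - {\<zero>}"
  then obtain a b where ab: "a \<in> A" "b \<in> A" "b \<noteq> \<zero>" "x \<in> carrier R" "b \<otimes> x = a"
    using fractionsE[OF assms] by (metis Diff_iff)
  have a0: "a \<noteq> \<zero>" using ab x car integral by auto
  have i: "inv x \<in> carrier R" "x \<otimes> inv x = \<one>" using subfield_m_inv[OF carrier_is_subfield, of x] ab x by auto
  have "a \<otimes> inv x = b \<otimes> (x \<otimes> inv x)"
    using ab(4) i(1) car[OF ab(2)] unfolding ab(5)[symmetric] by (rule_tac m_assoc)
  then show "inv x \<in> fractions A"
    using fractionsI[OF assms ab(2,1) a0 i(1)] i car[OF ab(2)] by simp
qed

lemma common_denominator:
  assumes "subring A R" "set p \<subseteq> fractions A"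
  obtains d where "d \<in> A" "d \<noteq> \<zero>" "set (map ((\<otimes>) d) p) \<subseteq> A"
proof -
  note A = subringE[OF assms(1)]
  have "\<exists>d. d \<in> A \<and> d \<noteq> \<zero> \<and> set (map ((\<otimes>) d) p) \<subseteq> A"
    using assms(2)
  proof (induct p)
    case Nil
    then show ?case using A(3) one_not_zero by auto
  next
    case (Cons x p)
    then obtain d where d: "d \<in> A" "d \<noteq> \<zero>" "set (map ((\<otimes>) d) p) \<subseteq> A" by auto
    obtain a b where ab: "a \<in> A" "b \<in> A" "b \<noteq> \<zero>" "x \<in> carrier R" "b \<otimes> x = a"
      using fractionsE[OF assms(1)] Cons(2) by (metis insert_subset list.simps(15))
    have c: "d \<in> carrier R" "b \<in> carrier R" using d ab A(1) by auto
    have p: "z \<in> carrier R" if "z \<in> set p" for z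
      using that Cons(2) subfieldE(3)[OF fractions_subfield[OF assms(1)]] by auto
    have "b \<otimes> d \<otimes> z \<in> A" if "z \<in> set p" for z
      using A(6)[OF ab(2), of "d \<otimes> z"] d(3) that p[OF that] c by (auto simp: m_assoc)
    moreover have "b \<otimes> d \<otimes> x = d \<otimes> a" using c ab(4) unfolding ab(5)[symmetric] by algebra
    moreover have "d \<otimes> a \<in> A" using A(6) d ab by blast
    moreover have "b \<otimes> d \<in> A" "b \<otimes> d \<noteq> \<zero>" using A(6) d ab c integral_iff by auto
    ultimately show ?case by (intro exI[of _ "b \<otimes> d"]) auto
  qed
  then show thesis using that by blast
qed

lemma algebraic_over_fractions:
  assumes "subring A R" "x \<in> carrier R"
  shows "(algebraic over (fractions A)) x \<longleftrightarrow> (algebraic over A) x"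
proof
  assume "(algebraic over A) x"
  then show "(algebraic over (fractions A)) x"
    using algebraic_mono[OF subset_fractions[OF assms(1)]] by (simp add: over_def)
next
  note K = fractions_subfield[OF assms(1)]
  assume "(algebraic over (fractions A)) x"
  then obtain p where p: "set p \<subseteq> fractions A" "\<not> set p \<subseteq> {\<zero>}" "eval p x = \<zero>"
    using algebraic_iff_relation[OF subfieldE(1)[OF K] assms(2)] by blast
  obtain d where d: "d \<in> A" "d \<noteq> \<zero>" "set (map ((\<otimes>) d) p) \<subseteq> A"
    using common_denominator[OF assms(1) p(1)] by blast
  have dc: "d \<in> carrier R" using d(1) subringE(1)[OF assms(1)] by blast
  have pc: "set p \<subseteq> carrier R" using p(1) subfieldE(3)[OF K] by blast
  have "eval (map ((\<otimes>) d) p) x = \<zero>" using eval_map_mult[OF pc dc assms(2)] p(3) dc by simp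
  moreover have "\<not> set (map ((\<otimes>) d) p) \<subseteq> {\<zero>}"
    using p(2) pc dc d(2) integral by fastforce
  ultimately show "(algebraic over A) x"
    using algebraic_iff_relation[OF assms] d(3) by blast
qed

text \<open>
  For a subring \<open>A\<close> this is a field: an algebraic equation over the fractions of \<open>A\<close> becomes one over
  \<open>A\<close> after clearing denominators.
\<close>
definition algebraics_over :: "'a set \<Rightarrow> 'a set"
  where "algebraics_over A = {x \<in> carrier R. (algebraic over A) x}"

lemma algebraics_over_fractions:
  assumes "subring A R" shows "algebraics_over (fractions A) = algebraics_over A"
  unfolding algebraics_over_def using algebraic_over_fractions[OF assms] by blast

lemma algebraics_over_subfield:
  assumes "subring A R" shows "subfield (algebraics_over A) R"
  using subfield_of_algebraics[OF fractions_subfield[OF assms]]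
  unfolding algebraics_over_fractions[OF assms, symmetric] by (simp add: algebraics_over_def)

lemma subset_algebraics_over:
  assumes "subring A R" shows "A \<subseteq> algebraics_over A"
  using algebraic_self[OF assms] subringE(1)[OF assms] unfolding algebraics_over_def by blast

text \<open>
  The finitely many coefficients of an equation for \<open>y\<close> over \<open>B\<close> generate a finite field extension
  of the fractions of \<open>A\<close>, and adjoining \<open>y\<close> keeps it finite.
\<close>
lemma algebraic_trans:
  assumes "subring A R" "B \<subseteq> algebraics_over A" "subring B R"
  shows "algebraics_over B \<subseteq> algebraics_over A"
proof
  fix y assume "y \<in> algebraics_over B"
  then have y: "y \<in> carrier R" "(algebraic over B) y" by (auto simp: algebraics_over_def)
  obtain p where p: "set p \<subseteq> B" "\<not> set p \<subseteq> {\<zero>}" "eval p y = \<zero>"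
    using algebraic_iff_relation[OF assms(3) y(1)] y(2) by blast
  define K where "K = fractions A"
  note K = fractions_subfield[OF assms(1), folded K_def]
  have alg: "(algebraic over K) x" if "x \<in> set p" for x
    using that p(1) assms(2) algebraics_over_fractions[OF assms(1), folded K_def]
    unfolding algebraics_over_def by blast
  have pc: "set p \<subseteq> carrier R" using p(1) subringE(1)[OF assms(3)] by blast
  define L where "L = finite_extension K p"
  have L: "subfield L R" "finite_dimension K L" "set p \<subseteq> L"
    using finite_extension_is_subfield[OF K pc alg] finite_extension_finite_dimension(1)[OF K pc alg]
      finite_extension_mem[OF subfieldE(1)[OF K] pc] unfolding L_def by auto
  have yL: "(algebraic over L) y"
    using algebraic_iff_relation[OF subfieldE(1)[OF L(1)] y(1)] p L(3) by blast
  have "finite_dimension L (simple_extension L y)"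
    using finite_dimension_simple_extension[OF L(1) y(1)] yL by blast
  moreover have "subfield (simple_extension L y) R"
    using simple_extension_is_subfield[OF L(1) y(1)] yL by blast
  ultimately have "finite_dimension K (simple_extension L y)"
    using telescopic_base_dim(1)[OF K L(1)] L(2) by blast
  then have "(algebraic over K) y"
    using finite_dimension_imp_algebraic[OF K simple_extension_is_subring[OF subfieldE(1)[OF L(1)] y(1)]]
      simple_extension_mem[OF subfieldE(1)[OF L(1)] y(1)] by blast
  then show "y \<in> algebraics_over A"
    using y(1) algebraics_over_fractions[OF assms(1), folded K_def] unfolding algebraics_over_def by blast
qed

section \<open>Exchange of transcendental elements\<close>

lemma eval_map_linear:
  assumes "\<And>x. x \<in> set p \<Longrightarrow> k x \<in> carrier R \<and> l x \<in> carrier R" "e \<in> carrier R" "c \<in> carrier R"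
  shows "eval (map (\<lambda>x. k x \<otimes> e \<oplus> l x) p) c = eval (map k p) c \<otimes> e \<oplus> eval (map l p) c"
  using assms(1)
proof (induct p)
  case Nil then show ?case using assms by simp
next
  case (Cons a p)
  have "eval (map k p) c \<in> carrier R" "eval (map l p) c \<in> carrier R"
    using Cons(2) assms(3) by (auto intro!: eval_in_carrier)
  moreover have "k a \<in> carrier R" "l a \<in> carrier R" "c [^] length p \<in> carrier R" using Cons(2) assms by auto
  ultimately show ?case using Cons assms(2) by simp algebra
qed

text \<open>
  Induction on the maximal degree in \<open>u\<close> of the coefficients \<open>p\<close> of a polynomial over \<open>A[u]\<close>: the
  step splits each coefficient as \<open>k x \<cdot> u + l x\<close> with \<open>l x\<close> its constant term. It allows two-variable
  polynomials over \<open>A\<close> to be handled without fixing a representation for them.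
\<close>
lemma simple_extension_list_induct:
  assumes A: "subring A R" and u: "u \<in> carrier R" and p: "set p \<subseteq> simple_extension A u"
    and zero: "\<And>p. set p \<subseteq> {\<zero>} \<Longrightarrow> P p"
    and step: "\<And>p k l. \<lbrakk>\<And>x. x \<in> set p \<Longrightarrow> k x \<in> simple_extension A u;
        \<And>x. x \<in> set p \<Longrightarrow> l x \<in> A; \<And>x. x \<in> set p \<Longrightarrow> x = k x \<otimes> u \<oplus> l x; P (map k p)\<rbrakk>
      \<Longrightarrow> P p"
  shows "P p"
proof -
  have bounded: "P p"
    if "\<forall>x\<in>set p. \<exists>r. set r \<subseteq> A \<and> length r \<le> m \<and> x = eval r u" for p m
    using that
  proof (induct m arbitrary: p)
    case 0
    then have "set p \<subseteq> {\<zero>}" by auto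
    then show ?case by (rule zero)
  next
    case (Suc m)
    define short where "short k \<longleftrightarrow> (\<exists>r. set r \<subseteq> A \<and> length r \<le> m \<and> k = eval r u)" for k
    have "\<exists>k l. short k \<and> l \<in> A \<and> x = k \<otimes> u \<oplus> l" if x: "x \<in> set p" for x
    proof -
      obtain r where r: "set r \<subseteq> A" "length r \<le> Suc m" "x = eval r u" using Suc(2) x by blast
      show ?thesis
      proof (cases r rule: rev_cases)
        case Nil
        then have "x = \<zero> \<otimes> u \<oplus> \<zero>" "\<zero> = eval [] u" using r u by auto
        then show ?thesis using subringE(2)[OF A] unfolding short_def
          by (metis empty_set empty_subsetI le0 list.size(3))
      next
        case (snoc r' a)
        then have "x = eval r' u \<otimes> u \<oplus> a"
          using r eval_append_aux[of r' a u] u subringE(1)[OF A] by auto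
        moreover have "set r' \<subseteq> A" "a \<in> A" "length r' \<le> m" using r(1,2) snoc by auto
        ultimately show ?thesis unfolding short_def by blast
      qed
    qed
    then have "\<forall>x\<in>set p. \<exists>k l. short k \<and> l \<in> A \<and> x = k \<otimes> u \<oplus> l" by blast
    from bchoice[OF this] obtain k
      where "\<forall>x\<in>set p. \<exists>l. short (k x) \<and> l \<in> A \<and> x = k x \<otimes> u \<oplus> l" ..
    from bchoice[OF this] obtain l
      where kl': "\<forall>x\<in>set p. short (k x) \<and> l x \<in> A \<and> x = k x \<otimes> u \<oplus> l x" ..
    have kl: "short (k x)" "l x \<in> A" "x = k x \<otimes> u \<oplus> l x" if "x \<in> set p" for x
      by (rule conjunct1[OF bspec[OF kl' that]], rule conjunct1[OF conjunct2[OF bspec[OF kl' that]]],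
          rule conjunct2[OF conjunct2[OF bspec[OF kl' that]]])
    show "P p"
    proof (rule step[OF _ kl(2,3)])
      show "k x \<in> simple_extension A u" if "x \<in> set p" for x
        using kl(1)[OF that] mem_simple_extension_iff[OF A u] unfolding short_def by metis
      show "P (map k p)" using Suc(1)[of "map k p"] kl(1) unfolding short_def by simp
    qed
  qed
  have "\<forall>x\<in>set p. \<exists>r. set r \<subseteq> A \<and> x = eval r u"
    using p mem_simple_extension_iff[OF A u] by blast
  from bchoice[OF this] obtain r where r: "\<forall>x\<in>set p. set (r x) \<subseteq> A \<and> x = eval (r x) u" ..
  define m where "m = Max (insert 0 ((\<lambda>x. length (r x)) ` set p))"
  have "\<And>x. x \<in> set p \<Longrightarrow> length (r x) \<le> m" unfolding m_def by simp
  then show ?thesis using bounded[of p m] r by blast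
qed

lemma transcendental_linear:
  assumes "subring B R" "e \<in> carrier R" "(transcendental over B) e"
    and "x \<in> simple_extension B e" "z \<in> B" "x \<otimes> e \<oplus> z = \<zero>"
  shows "x = \<zero> \<and> z = \<zero>"
proof -
  obtain q where q: "set q \<subseteq> B" "x = eval q e"
    using mem_simple_extension_iff[OF assms(1,2)] assms(4) by blast
  have c: "set q \<subseteq> carrier R" "z \<in> carrier R" using q(1) assms(5) subringE(1)[OF assms(1)] by auto
  have "eval (q @ [z]) e = \<zero>"
    using eval_append_aux[OF c assms(2)] q(2) assms(6) by simp
  then have "set (q @ [z]) \<subseteq> {\<zero>}"
    using transcendentalD[OF assms(1-3), of "q @ [z]"] q(1) assms(5) by simp
  then show ?thesis using q(2) eval_zero_list[OF _ assms(2)] by simp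
qed

text \<open>
  The exchange property of algebraic dependence. In a relation for \<open>c\<close> over \<open>A[e]\<close>, separate the
  constant terms in \<open>e\<close> of all coefficients: as \<open>e\<close> is transcendental over \<open>A[c]\<close>, the constant part
  and the remaining part vanish separately. The first is a relation for \<open>c\<close> over \<open>A\<close>, the second a
  relation of smaller degree in \<open>e\<close>.
\<close>
lemma transcendental_exchange:
  assumes A: "subring A R" and c: "c \<in> carrier R" and e: "e \<in> carrier R"
    and tc: "(transcendental over A) c" and te: "(transcendental over (simple_extension A c)) e"
  shows "(transcendental over (simple_extension A e)) c"
proof -
  define B where "B = simple_extension A c"
  have B: "subring B R" "A \<subseteq> B" "c \<in> B"
    using simple_extension_is_subring[OF A c] simple_extension_incl[OF subringE(1)[OF A] c]
      simple_extension_mem[OF A c] unfolding B_def by auto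
  define S where "S = simple_extension B e"
  have S: "subring S R" "B \<subseteq> S" "e \<in> S"
    using simple_extension_is_subring[OF B(1) e] simple_extension_incl[OF subringE(1)[OF B(1)] e]
      simple_extension_mem[OF B(1) e] unfolding S_def by auto
  have Sc: "S \<subseteq> carrier R" using subringE(1)[OF S(1)] .
  have AS: "simple_extension A e \<subseteq> S"
    using simple_extension_subring_incl[OF S(1) _ S(3)] B(2) S(2) by blast
  have main: "eval p c = \<zero> \<longrightarrow> set p \<subseteq> {\<zero>}" if "set p \<subseteq> simple_extension A e" for p
    using A e that
  proof (rule simple_extension_list_induct)
    fix p k l
    assume k: "\<And>x. x \<in> set p \<Longrightarrow> k x \<in> simple_extension A e"
      and l: "\<And>x. x \<in> set p \<Longrightarrow> l x \<in> A"
      and kl: "\<And>x. x \<in> set p \<Longrightarrow> x = k x \<otimes> e \<oplus> l x"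
      and IH: "eval (map k p) c = \<zero> \<longrightarrow> set (map k p) \<subseteq> {\<zero>}"
    have klc: "k x \<in> carrier R \<and> l x \<in> carrier R" if "x \<in> set p" for x
      using k[OF that] l[OF that] AS Sc B(2) S(2) by blast
    show "eval p c = \<zero> \<longrightarrow> set p \<subseteq> {\<zero>}"
    proof
      assume z: "eval p c = \<zero>"
      have "map (\<lambda>x. k x \<otimes> e \<oplus> l x) p = p" by (rule map_idI) (rule kl[symmetric])
      then have sum: "eval (map k p) c \<otimes> e \<oplus> eval (map l p) c = \<zero>"
        using eval_map_linear[where p = p and k = k and l = l, OF klc e c] z by simp
      have "eval (map k p) c \<in> S"
        using eval_in_subring[OF S(1), of "map k p" c] k AS B(3) S(2) by auto
      moreover have "eval (map l p) c \<in> B"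
        using eval_in_subring[OF B(1), of "map l p" c] l B(2,3) by auto
      ultimately have "eval (map k p) c = \<zero>" "eval (map l p) c = \<zero>"
        using transcendental_linear[OF B(1) e te[folded B_def], folded S_def] sum by blast+
      then have kz: "set (map k p) \<subseteq> {\<zero>}" and lz: "set (map l p) \<subseteq> {\<zero>}"
        using IH transcendentalD[OF A c tc, of "map l p"] l by auto
      have "x = \<zero>" if "x \<in> set p" for x
      proof -
        have "k x = \<zero>" "l x = \<zero>" using kz lz that by auto
        then have "k x \<otimes> e \<oplus> l x = \<zero>" using e by simp
        with kl[OF that] show ?thesis by (rule trans)
      qed
      then show "set p \<subseteq> {\<zero>}" by blast
    qed
  qed blast
  then show ?thesis
    using algebraic_iff_relation[OF simple_extension_is_subring[OF A e] c] by (auto simp: over_def)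
qed

section \<open>Descent of divisibility along algebraic extensions\<close>

lemma nat_pow_in_subring:
  assumes "subring A R" "a \<in> A" shows "a [^] (n::nat) \<in> A"
  by (induct n) (use assms subringE[OF assms(1)] in auto)

text \<open>
  Minimality of the length makes the powers of \<open>y\<close> below the degree linearly independent, which is
  how the relation is used.
\<close>
lemma minimal_relation:
  assumes A: "subring A R" and y: "y \<in> carrier R" "(algebraic over A) y"
  obtains a r where "a \<in> A" "a \<noteq> \<zero>" "set r \<subseteq> A" "eval (a # r) y = \<zero>"
    "\<And>q. \<lbrakk>set q \<subseteq> A; length q \<le> length r; eval q y = \<zero>\<rbrakk> \<Longrightarrow> set q \<subseteq> {\<zero>}"
proof -
  let ?P = "\<lambda>p. set p \<subseteq> A \<and> \<not> set p \<subseteq> {\<zero>} \<and> eval p y = \<zero>"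
  have "\<exists>p. ?P p" using algebraic_iff_relation[OF A y(1)] y(2) by blast
  then obtain p where p: "?P p" and min: "\<And>q. ?P q \<Longrightarrow> length p \<le> length q"
    using ex_has_least_nat[of ?P _ length] by blast
  obtain a r where ar: "p = a # r" using p by (cases p) auto
  have small: "set q \<subseteq> {\<zero>}" if "set q \<subseteq> A" "length q \<le> length r" "eval q y = \<zero>" for q
  proof (rule ccontr)
    assume "\<not> ?thesis"
    then have "length p \<le> length q" using that min[of q] by blast
    then show False using that(2) ar by simp
  qed
  have rc: "set r \<subseteq> carrier R" using p ar subringE(1)[OF A] by auto
  have "a \<noteq> \<zero>"
  proof
    assume a: "a = \<zero>"
    then have "eval r y = \<zero>" using p ar rc y(1) by (simp add: eval_in_carrier)
    then have "set r \<subseteq> {\<zero>}" using small[of r] p ar by auto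
    then show False using p ar a by auto
  qed
  then show thesis using that[of a r] p ar small by auto
qed

lemma eval_map2:
  assumes "length t = length r" "set t \<subseteq> carrier R" "set r \<subseteq> carrier R"
    "a \<in> carrier R" "h \<in> carrier R" "y \<in> carrier R"
  shows "eval (map2 (\<lambda>x z. a \<otimes> x \<ominus> h \<otimes> z) t r) y = a \<otimes> eval t y \<ominus> h \<otimes> eval r y"
  using assms(1-3)
proof (induct rule: list_induct2)
  case Nil
  then show ?case using assms by (simp add: minus_eq)
next
  case (Cons x xs z zs)
  have "eval xs y \<in> carrier R" "eval zs y \<in> carrier R" "y [^] length zs \<in> carrier R"
    "x \<in> carrier R" "z \<in> carrier R"
    using Cons assms by (auto intro!: eval_in_carrier)
  moreover from this have "(a \<otimes> x \<ominus> h \<otimes> z) \<otimes> y [^] length zs \<oplus> (a \<otimes> eval xs y \<ominus> h \<otimes> eval zs y)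
      = a \<otimes> (x \<otimes> y [^] length zs \<oplus> eval xs y) \<ominus> h \<otimes> (z \<otimes> y [^] length zs \<oplus> eval zs y)"
    using assms(4,5) by algebra
  ultimately show ?case using Cons assms(4-6) by simp
qed

text \<open>
  After multiplication by a power of the leading coefficient \<open>a\<close>, every element of \<open>A[y]\<close> is an
  \<open>A\<close>-combination of the powers of \<open>y\<close> below the degree of the relation.
\<close>
lemma pseudo_division:
  assumes A: "subring A R" and y: "y \<in> carrier R"
    and a: "a \<in> A" and r: "set r \<subseteq> A" and rel: "eval (a # r) y = \<zero>"
    and s: "s \<in> simple_extension A y"
  shows "\<exists>N::nat. \<exists>q. set q \<subseteq> A \<and> length q \<le> length r \<and> a [^] N \<otimes> s = eval q y"
  using s
proof (induct rule: simple_extension.induct)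
  case zero
  have "a [^] (0::nat) \<otimes> \<zero> = eval [] y" using a subringE(1)[OF A] by auto
  then show ?case using subringE(1)[OF A] a by (intro exI[of _ 0] exI[of _ "[]"]) auto
next
  case (lin k1 k2)
  note Ac = subringE(1)[OF A]
  have ac: "a \<in> carrier R" using a Ac by blast
  have powA: "a [^] (n::nat) \<in> A" for n
    by (induct n) (use a subringE[OF A] in auto)
  obtain N :: nat and q where q: "set q \<subseteq> A" "length q \<le> length r" "a [^] N \<otimes> k1 = eval q y"
    using lin(2) by blast
  have k: "k1 \<in> carrier R" "k2 \<in> carrier R" "k2 \<in> A"
    using lin simple_extension_in_carrier[OF Ac y] Ac by auto
  define z where "z = a [^] N \<otimes> k2"
  have z: "z \<in> A" "z \<in> carrier R" unfolding z_def using subringE(6)[OF A powA k(3)] Ac by auto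
  have pw: "a [^] N \<in> carrier R" using ac by simp
  have qz: "eval (q @ [z]) y = a [^] N \<otimes> (k1 \<otimes> y \<oplus> k2)"
    using eval_append_aux[OF _ z(2) y, of q] q Ac unfolding q(3)[symmetric] z_def
    using k(1,2) y pw by (simp add: r_distr m_assoc subset_trans)
  show ?case
  proof (cases "length q < length r")
    case True
    then show ?thesis using qz q(1) z(1) by (intro exI[of _ N] exI[of _ "q @ [z]"]) auto
  next
    case False
    then have len: "length q = length r" using q(2) by simp
    then obtain h t where ht: "q @ [z] = h # t" by (cases "q @ [z]") auto
    have "set (q @ [z]) \<subseteq> A" using q(1) z(1) by simp
    then have hA: "h \<in> A" "set t \<subseteq> A" unfolding ht by auto
    have lt: "length t = length r" using arg_cong[OF ht, of length] len by simp
    have ca: "h \<in> carrier R" "set t \<subseteq> carrier R" "set r \<subseteq> carrier R" using hA r Ac by auto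
    let ?q = "map2 (\<lambda>x z. a \<otimes> x \<ominus> h \<otimes> z) t r"
    have e: "eval t y \<in> carrier R" "eval r y \<in> carrier R" "y [^] length r \<in> carrier R"
      using ca y by (auto intro!: eval_in_carrier)
    have e1: "h \<otimes> y [^] length r \<oplus> eval t y = a [^] N \<otimes> (k1 \<otimes> y \<oplus> k2)"
      using qz ht lt by simp
    have e2: "a \<otimes> y [^] length r \<oplus> eval r y = \<zero>" using rel by simp
    have "a [^] Suc N \<otimes> (k1 \<otimes> y \<oplus> k2) = a \<otimes> (a [^] N \<otimes> (k1 \<otimes> y \<oplus> k2))"
      using pw ac k y by (simp add: m_ac)
    also have "\<dots> = a \<otimes> (h \<otimes> y [^] length r \<oplus> eval t y) \<ominus> h \<otimes> (a \<otimes> y [^] length r \<oplus> eval r y)"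
      unfolding e1 e2 using ac ca pw k y by (simp add: minus_eq)
    also have "\<dots> = a \<otimes> eval t y \<ominus> h \<otimes> eval r y"
      using e ac ca(1) by algebra
    also have "\<dots> = eval ?q y" using eval_map2[OF lt ca(2,3) ac ca(1) y] by simp
    finally have "a [^] Suc N \<otimes> (k1 \<otimes> y \<oplus> k2) = eval ?q y" .
    moreover have "set ?q \<subseteq> A"
    proof
      fix x assume "x \<in> set ?q"
      then obtain u v where "u \<in> set t" "v \<in> set r" "x = a \<otimes> u \<oplus> \<ominus> (h \<otimes> v)"
        by (auto simp: minus_eq dest: set_zip_leftD set_zip_rightD)
      then show "x \<in> A" using hA r a subringE(5-7)[OF A] by (meson subsetD)
    qed
    moreover have "length ?q \<le> length r" by simp
    ultimately show ?thesis by blast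
  qed
qed

text \<open>
  The multiple is the lowest nonzero coefficient of a relation for \<open>v\<close>, up to sign.
\<close>
lemma algebraic_multiple:
  assumes A: "subring A R" and B: "subring B R" "A \<subseteq> B"
    and v: "v \<in> B" "v \<noteq> \<zero>" "(algebraic over A) v"
  obtains t where "t \<in> B" "v \<otimes> t \<in> A" "v \<otimes> t \<noteq> \<zero>"
proof -
  have vc: "v \<in> carrier R" using v(1) subringE(1)[OF B(1)] by blast
  have "\<exists>t\<in>B. v \<otimes> t \<in> A \<and> v \<otimes> t \<noteq> \<zero>" if "set p \<subseteq> A" "\<not> set p \<subseteq> {\<zero>}" "eval p v = \<zero>" for p
    using that
  proof (induct p rule: rev_induct)
    case (snoc a p)
    have s: "set p \<subseteq> A" "a \<in> A" "set p \<subseteq> carrier R" "a \<in> carrier R"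
      using snoc(2) subringE(1)[OF A] by auto
    define x where "x = eval p v"
    have x: "x \<in> B" "x \<in> carrier R"
      using eval_in_subring[OF B(1) _ v(1), of p] s(1) B(2) subringE(1)[OF B(1)] unfolding x_def by auto
    have eq: "x \<otimes> v \<oplus> a = \<zero>"
      using eval_append_aux[OF s(3,4) vc] snoc(4) unfolding x_def by simp
    show ?case
    proof (cases "a = \<zero>")
      case True
      then have "x \<otimes> v = \<zero>" using eq x vc by simp
      then have "eval p v = \<zero>" using integral_iff x vc v(2) unfolding x_def by blast
      then show ?thesis using snoc(1)[OF s(1)] snoc(3) True by auto
    next
      case False
      have "v \<otimes> (\<ominus> x) = a"
        using minus_equality[of a "x \<otimes> v"] eq x(2) vc s(4) a_comm[of "x \<otimes> v" a] m_comm[of v x]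
        by (simp add: r_minus)
      then show ?thesis using False s(2) subringE(5)[OF B(1) x(1)] by metis
    qed
  qed simp
  then show thesis using that algebraic_iff_relation[OF A vc] v(3) by blast
qed

text \<open>
  After inverting the leading coefficient \<open>a\<close> of a minimal relation, \<open>A[y]\<close> is free over \<open>A\<close> with
  basis \<open>1, y, \<dots>, y\<^sup>d\<^sup>-\<^sup>1\<close>. If \<open>v t = v\<^sub>0 \<in> A\<close>, then \<open>w s = b v\<^sup>k\<close> gives \<open>w s' = b v\<^sub>0\<^sup>k\<close> with
  \<open>s' = s t\<^sup>k\<close>, and the coordinates at \<open>1\<close> show that \<open>w\<close> divides \<open>b (a v\<^sub>0)\<^sup>l\<close> in \<open>A\<close>. So \<open>u = a v\<^sub>0\<close>
  works for all \<open>w\<close> and \<open>b\<close> at once.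
\<close>
lemma divisibility_descent_simple:
  assumes A: "subring A R" and y: "y \<in> carrier R" and alg: "carrier R \<subseteq> algebraics_over A"
    and v: "v \<in> simple_extension A y" "v \<noteq> \<zero>"
  obtains u where "u \<in> A" "u \<noteq> \<zero>"
    "\<And>w b s k. \<lbrakk>w \<in> A; b \<in> A; s \<in> simple_extension A y; w \<otimes> s = b \<otimes> v [^] (k::nat)\<rbrakk>
        \<Longrightarrow> \<exists>l::nat. \<exists>s\<in>A. w \<otimes> s = b \<otimes> u [^] l"
proof -
  define B where "B = simple_extension A y"
  note Ac = subringE(1)[OF A]
  have B: "subring B R" "A \<subseteq> B"
    using simple_extension_is_subring[OF A y] simple_extension_incl[OF Ac y] unfolding B_def by auto
  note Bc = subringE(1)[OF B(1)]
  have va: "(algebraic over A) v" and ya: "(algebraic over A) y"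
    using v(1) alg Bc y unfolding algebraics_over_def B_def by auto
  obtain t where t: "t \<in> B" "v \<otimes> t \<in> A" "v \<otimes> t \<noteq> \<zero>"
    using algebraic_multiple[OF A B v(1)[folded B_def] v(2) va] by blast
  obtain a r where ar: "a \<in> A" "a \<noteq> \<zero>" "set r \<subseteq> A" "eval (a # r) y = \<zero>"
    and min: "\<And>q. \<lbrakk>set q \<subseteq> A; length q \<le> length r; eval q y = \<zero>\<rbrakk> \<Longrightarrow> set q \<subseteq> {\<zero>}"
    using minimal_relation[OF A y ya] by metis
  define v0 where "v0 = v \<otimes> t"
  have v0: "v0 \<in> A" "v0 \<noteq> \<zero>" using t v0_def by auto
  have car: "v \<in> carrier R" "t \<in> carrier R" "v0 \<in> carrier R" "a \<in> carrier R"
    using v(1) t(1) v0(1) ar(1) Ac Bc unfolding B_def by auto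
  have u: "a \<otimes> v0 \<in> A" "a \<otimes> v0 \<noteq> \<zero>"
    using subringE(6)[OF A ar(1) v0(1)] integral_iff car ar(2) v0(2) by auto
  have "\<exists>l::nat. \<exists>s\<in>A. w \<otimes> s = b \<otimes> (a \<otimes> v0) [^] l"
    if w: "w \<in> A" and b: "b \<in> A" and s: "s \<in> B" and eq: "w \<otimes> s = b \<otimes> v [^] k" for w b s and k :: nat
  proof -
    have c: "w \<in> carrier R" "b \<in> carrier R" "s \<in> carrier R" using w b s Ac Bc by auto
    have tk: "t [^] k \<in> B" "t [^] k \<in> carrier R" using nat_pow_in_subring[OF B(1) t(1)] Bc by auto
    have st: "s \<otimes> t [^] k \<in> B" using subringE(6)[OF B(1) s tk(1)] .
    then obtain N :: nat and q where q: "set q \<subseteq> A" "length q \<le> length r"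
        "a [^] N \<otimes> (s \<otimes> t [^] k) = eval q y"
      using pseudo_division[OF A y ar(1,3,4)] unfolding B_def by blast
    define \<beta> where "\<beta> = a [^] N \<otimes> (b \<otimes> v0 [^] k)"
    have pA: "a [^] N \<in> A" "a [^] k \<in> A" "v0 [^] k \<in> A" "v0 [^] N \<in> A"
      using nat_pow_in_subring[OF A] ar(1) v0(1) by auto
    have pc: "a [^] N \<in> carrier R" "a [^] k \<in> carrier R" "v0 [^] k \<in> carrier R" "v0 [^] N \<in> carrier R"
      "v [^] k \<in> carrier R" using car by auto
    have \<beta>: "\<beta> \<in> A" "\<beta> \<in> carrier R"
      unfolding \<beta>_def using subringE(6)[OF A] pA b Ac by auto
    have "w \<otimes> (a [^] N \<otimes> (s \<otimes> t [^] k)) = a [^] N \<otimes> ((w \<otimes> s) \<otimes> t [^] k)"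
      using c tk(2) pc(1) by (simp add: m_ac)
    also have "\<dots> = a [^] N \<otimes> (b \<otimes> (v [^] k \<otimes> t [^] k))"
      unfolding eq using c tk(2) pc by (simp add: m_ac)
    also have "v [^] k \<otimes> t [^] k = v0 [^] k"
      unfolding v0_def using nat_pow_distrib[OF car(1,2)] by simp
    finally have weq: "w \<otimes> eval q y = \<beta>" unfolding q(3) \<beta>_def .
    obtain z where z: "z \<in> A" "w \<otimes> z = \<beta>"
    proof (cases q rule: rev_cases)
      case Nil
      then have "w \<otimes> \<zero> = \<beta>" using weq by simp
      then show thesis using that subringE(2)[OF A] by blast
    next
      case (snoc q' z)
      have q': "set q' \<subseteq> A" "z \<in> A" using q(1) snoc by auto
      then have q'c: "set q' \<subseteq> carrier R" "z \<in> carrier R" using Ac by auto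
      have e: "eval q' y \<in> carrier R" using eval_in_carrier[OF q'c(1) y] .
      have wz: "w \<otimes> z \<ominus> \<beta> \<in> A"
        unfolding minus_eq using subringE(5-7)[OF A] w q'(2) \<beta>(1) by simp
      have mc: "set (map ((\<otimes>) w) q') \<subseteq> A" using subringE(6)[OF A w] q'(1) by auto
      have "eval (map ((\<otimes>) w) q' @ [w \<otimes> z \<ominus> \<beta>]) y = w \<otimes> eval q' y \<otimes> y \<oplus> (w \<otimes> z \<ominus> \<beta>)"
        using eval_append_aux[OF subset_trans[OF mc Ac] _ y, of "w \<otimes> z \<ominus> \<beta>"] wz Ac
          eval_map_mult[OF q'c(1) c(1) y] by auto
      also have "\<dots> = w \<otimes> (eval q' y \<otimes> y \<oplus> z) \<ominus> \<beta>"
        using e y c(1) q'c(2) \<beta>(2) by algebra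
      also have "eval q' y \<otimes> y \<oplus> z = eval q y"
        using eval_append_aux[OF q'c y] snoc by simp
      finally have "eval (map ((\<otimes>) w) q' @ [w \<otimes> z \<ominus> \<beta>]) y = \<zero>" using weq \<beta>(2) by simp
      then have "set (map ((\<otimes>) w) q' @ [w \<otimes> z \<ominus> \<beta>]) \<subseteq> {\<zero>}"
        using min[of "map ((\<otimes>) w) q' @ [w \<otimes> z \<ominus> \<beta>]"] mc wz q(2) snoc by simp
      then have "w \<otimes> z = \<beta>" using c(1) q'c(2) \<beta>(2) by simp
      then show thesis using that q'(2) by blast
    qed
    have zc: "z \<in> carrier R" using z(1) Ac by blast
    have "w \<otimes> (z \<otimes> (a [^] k \<otimes> v0 [^] N)) = \<beta> \<otimes> (a [^] k \<otimes> v0 [^] N)"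
      unfolding z(2)[symmetric] using zc c(1) pc by (simp add: m_ac)
    also have "\<dots> = b \<otimes> ((a [^] N \<otimes> a [^] k) \<otimes> (v0 [^] N \<otimes> v0 [^] k))"
      unfolding \<beta>_def using c pc by (simp add: m_ac)
    also have "\<dots> = b \<otimes> (a \<otimes> v0) [^] (N + k)"
      using car by (simp add: nat_pow_mult nat_pow_distrib)
    finally show ?thesis
      using subringE(6)[OF A] z(1) pA by blast
  qed
  then show thesis using that[OF u] unfolding B_def by blast
qed

text \<open>
  In geometric terms: if \<open>w\<close> has a zero in \<open>Spec A\<close> where \<open>b u\<close> does not vanish, then \<open>w\<close> has a zero
  in \<open>Spec A[xs]\<close> where \<open>b v\<close> does not vanish. Quantifying over the factor \<open>b\<close> and allowing powers of
  \<open>v\<close> makes the statement stable under composition along a tower of simple extensions.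
\<close>
lemma divisibility_descent:
  assumes A: "subring A R" and xs: "set xs \<subseteq> carrier R" and alg: "carrier R \<subseteq> algebraics_over A"
    and v: "v \<in> finite_extension A xs" "v \<noteq> \<zero>"
  obtains u where "u \<in> A" "u \<noteq> \<zero>"
    "\<And>w b s k. \<lbrakk>w \<in> A; b \<in> A; s \<in> finite_extension A xs; w \<otimes> s = b \<otimes> v [^] (k::nat)\<rbrakk>
        \<Longrightarrow> \<exists>l::nat. \<exists>s\<in>A. w \<otimes> s = b \<otimes> u [^] l"
proof -
  have "\<exists>u\<in>A. u \<noteq> \<zero> \<and> (\<forall>w\<in>A. \<forall>b\<in>A. \<forall>s\<in>finite_extension A xs. \<forall>k::nat.
      w \<otimes> s = b \<otimes> v [^] k \<longrightarrow> (\<exists>l::nat. \<exists>s\<in>A. w \<otimes> s = b \<otimes> u [^] l))"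
    using xs v
  proof (induct xs arbitrary: v)
    case Nil
    then show ?case by auto
  next
    case (Cons x xs)
    let ?B = "finite_extension A xs"
    have B: "subring ?B R" "A \<subseteq> ?B" and x: "x \<in> carrier R"
      using finite_extension_is_subring[OF A] finite_extension_incl[OF subringE(1)[OF A]] Cons(2) by auto
    have algB: "carrier R \<subseteq> algebraics_over ?B"
      using alg algebraic_mono[OF B(2)] unfolding algebraics_over_def over_def by blast
    have v': "v \<in> simple_extension ?B x" using Cons(3) by simp
    obtain u where u: "u \<in> ?B" "u \<noteq> \<zero>"
      and du: "\<And>w b s k. \<lbrakk>w \<in> ?B; b \<in> ?B; s \<in> simple_extension ?B x; w \<otimes> s = b \<otimes> v [^] (k::nat)\<rbrakk>
        \<Longrightarrow> \<exists>l::nat. \<exists>s\<in>?B. w \<otimes> s = b \<otimes> u [^] l"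
      using divisibility_descent_simple[OF B(1) x algB v' Cons(4)] by metis
    obtain u' where u': "u' \<in> A" "u' \<noteq> \<zero>"
      and du': "\<forall>w\<in>A. \<forall>b\<in>A. \<forall>s\<in>?B. \<forall>k::nat.
      w \<otimes> s = b \<otimes> u [^] k \<longrightarrow> (\<exists>l::nat. \<exists>s\<in>A. w \<otimes> s = b \<otimes> u' [^] l)"
      using Cons(1)[OF _ u] Cons(2) by auto
    have "\<exists>l::nat. \<exists>s\<in>A. w \<otimes> s = b \<otimes> u' [^] l"
      if "w \<in> A" "b \<in> A" "s \<in> finite_extension A (x # xs)" "w \<otimes> s = b \<otimes> v [^] k" for w b s and k :: nat
    proof -
      have "\<exists>l::nat. \<exists>s'\<in>?B. w \<otimes> s' = b \<otimes> u [^] l"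
        using du[of w b s k] that B(2) by auto
      then show ?thesis using du' that(1,2) by blast
    qed
    then show ?case using u' by blast
  qed
  then show thesis using that by blast
qed

end

section \<open>Existence and height of prime ideals\<close>

text \<open>
  An ideal maximal among those containing \<open>J\<close> and avoiding \<open>S\<close> is prime: if \<open>a\<close> and \<open>b\<close> lie
  outside it, adjoining either one reaches \<open>S\<close>, and then the product of the two elements of \<open>S\<close> lies in
  the ideal as soon as \<open>a b\<close> does.
\<close>
lemma (in cring) exists_primeideal_disjoint:
  assumes J: "ideal J R" and S: "S \<subseteq> carrier R" "\<one> \<in> S" "\<And>s t. \<lbrakk>s \<in> S; t \<in> S\<rbrakk> \<Longrightarrow> s \<otimes> t \<in> S"
    and disj: "J \<inter> S = {}"
  obtains P where "primeideal P R" "J \<subseteq> P" "P \<inter> S = {}"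
proof -
  let ?I = "{I. ideal I R \<and> J \<subseteq> I \<and> I \<inter> S = {}}"
  have "\<exists>M\<in>?I. \<forall>I\<in>?I. M \<subseteq> I \<longrightarrow> I = M"
  proof (rule subset_Zorn_nonempty)
    show "?I \<noteq> {}" using J disj by blast
  next
    fix C assume C: "C \<noteq> {}" "subset.chain ?I C"
    have "subset.chain {I. ideal I R} C"
      using C(2) unfolding subset.chain_def by auto
    then have "ideal (\<Union>C) R" using chain_Union_is_ideal[of C] C(1) by simp
    then show "\<Union>C \<in> ?I" using C unfolding subset.chain_def by fast
  qed
  then obtain P where P: "ideal P R" "J \<subseteq> P" "P \<inter> S = {}"
    and max: "\<And>I. \<lbrakk>ideal I R; I \<inter> S = {}; P \<subseteq> I\<rbrakk> \<Longrightarrow> I = P" by auto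
  interpret P: ideal P R by (rule P(1))
  have meets: "\<exists>p\<in>P. \<exists>x\<in>carrier R. p \<oplus> x \<otimes> a \<in> S" if a: "a \<in> carrier R" "a \<notin> P" for a
  proof -
    let ?K = "P <+>\<^bsub>R\<^esub> PIdl a"
    have K: "ideal ?K R" using add_ideals[OF P(1) cgenideal_ideal[OF a(1)]] .
    have z: "\<zero> \<in> PIdl a" using cgenideal_ideal[OF a(1)] by (simp add: additive_subgroup.zero_closed ideal.axioms(1))
    have "P \<subseteq> ?K"
    proof
      fix p assume p: "p \<in> P"
      then have "p = p \<oplus> \<zero>" using P.a_subset by auto
      then show "p \<in> ?K" using p z unfolding set_add_def set_mult_def by force
    qed
    moreover have "a \<in> ?K"
    proof -
      have "a = \<zero> \<oplus> a" using a by simp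
      then show ?thesis using P.zero_closed cgenideal_self[OF a(1)] unfolding set_add_def set_mult_def by force
    qed
    ultimately have "?K \<inter> S \<noteq> {}" using max[OF K] a(2) by blast
    then show ?thesis unfolding set_add_def set_mult_def cgenideal_def by auto
  qed
  have "primeideal P R"
  proof (rule primeidealI[OF P(1) is_cring])
    show "carrier R \<noteq> P" using P(3) S(1,2) by blast
  next
    fix a b assume ab: "a \<in> carrier R" "b \<in> carrier R" "a \<otimes> b \<in> P"
    show "a \<in> P \<or> b \<in> P"
    proof (rule ccontr)
      assume "\<not> ?thesis"
      then obtain p x q y where e: "p \<in> P" "x \<in> carrier R" "p \<oplus> x \<otimes> a \<in> S"
          "q \<in> P" "y \<in> carrier R" "q \<oplus> y \<otimes> b \<in> S"
        using meets ab(1,2) by metis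
      have c: "p \<in> carrier R" "q \<in> carrier R" using e P.a_subset by auto
      have "(p \<oplus> x \<otimes> a) \<otimes> (q \<oplus> y \<otimes> b) = (q \<oplus> y \<otimes> b) \<otimes> p \<oplus> ((x \<otimes> a) \<otimes> q \<oplus> (x \<otimes> y) \<otimes> (a \<otimes> b))"
        using c e(2,5) ab by algebra
      also have "\<dots> \<in> P"
        using P.a_closed[OF P.I_l_closed P.a_closed[OF P.I_l_closed P.I_l_closed]] e ab by simp
      finally show False using S(3)[OF e(3,6)] P(3) by blast
    qed
  qed
  then show thesis using that P by blast
qed

lemma (in domain) prime_height_one:
  assumes P: "primeideal P R" "P \<noteq> {\<zero>}"
    and below: "\<And>Q. \<lbrakk>primeideal Q R; Q \<subset> P\<rbrakk> \<Longrightarrow> Q = {\<zero>}"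
  shows "prime_height R P = 1"
proof -
  let ?S = "{enat n | n. \<exists>Q :: nat \<Rightarrow> 'a set.
           (\<forall>i\<le>n. primeideal (Q i) R) \<and> (\<forall>i<n. Q i \<subset> Q (Suc i)) \<and> Q n = P}"
  have zero: "\<zero> \<in> I" if "primeideal I R" for I
    using that by (simp add: additive_subgroup.zero_closed ideal.axioms(1) primeideal.axioms(1))
  have "enat 1 \<in> ?S"
    using P zeroprimeideal zero[OF P(1)]
    by (auto intro!: exI[of _ "\<lambda>i. if i = 0 then {\<zero>} else P"])
  moreover have "x \<le> enat 1" if "x \<in> ?S" for x
  proof -
    obtain n and Q :: "nat \<Rightarrow> 'a set" where x: "x = enat n"
      and Q: "\<forall>i\<le>n. primeideal (Q i) R" "\<forall>i<n. Q i \<subset> Q (Suc i)" "Q n = P"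
      using \<open>x \<in> ?S\<close> by blast
    have "\<not> n \<ge> 2"
    proof
      assume "n \<ge> 2"
      then obtain m where m: "n = Suc (Suc m)" by (metis add_2_eq_Suc le_Suc_ex)
      have "Q (Suc m) \<subset> P" using Q(2,3) m by auto
      then have "Q (Suc m) = {\<zero>}" using below Q(1) m by auto
      moreover have "Q m \<subset> Q (Suc m)" using Q(2) m by auto
      moreover have "\<zero> \<in> Q m" using zero Q(1) m by auto
      ultimately show False by auto
    qed
    then show ?thesis using x by (simp add: not_less_eq_eq numeral_2_eq_2)
  qed
  ultimately have "Sup ?S = enat 1" by (intro antisym Sup_least Sup_upper)
  then show ?thesis unfolding prime_height_def by (simp add: one_enat_def)
qed

section \<open>The differential core of a prime ideal\<close>

context differential_ring
begin

lemma D_zero: "D \<zero> = \<zero>"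
proof -
  have "D \<zero> \<oplus> D \<zero> = D \<zero> \<oplus> \<zero>" using D_add[of \<zero> \<zero>] D_closed by simp
  then show ?thesis using D_closed by (metis add.l_cancel zero_closed)
qed

lemma D_uminus: "a \<in> carrier R \<Longrightarrow> D (\<ominus> a) = \<ominus> D a"
proof -
  assume a: "a \<in> carrier R"
  have "D (\<ominus> a) \<oplus> D a = \<zero>" using D_add[of "\<ominus> a" a] a D_zero by (simp add: l_neg)
  then show ?thesis using minus_equality[of "D (\<ominus> a)" "D a"] a D_closed by simp
qed

lemma D_one: "D \<one> = \<zero>"
proof -
  have "D \<one> \<oplus> D \<one> = D \<one> \<oplus> \<zero>" using D_mult[of \<one> \<one>] D_closed by simp
  then show ?thesis using D_closed by (metis add.l_cancel zero_closed one_closed)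
qed

lemma D_add_pow_one: "D (add_pow R (n::nat) \<one>) = \<zero>"
  by (induct n) (simp_all add: D_zero D_one D_add)

lemma D_minus: "\<lbrakk>a \<in> carrier R; b \<in> carrier R\<rbrakk> \<Longrightarrow> D (a \<ominus> b) = D a \<ominus> D b"
  by (simp add: minus_eq D_add D_uminus)

lemma Dn_closed: "a \<in> carrier R \<Longrightarrow> (D ^^ n) a \<in> carrier R"
  by (induct n) (simp_all add: D_closed)

lemma Dn_add: "\<lbrakk>a \<in> carrier R; b \<in> carrier R\<rbrakk> \<Longrightarrow> (D ^^ n) (a \<oplus> b) = (D ^^ n) a \<oplus> (D ^^ n) b"
  by (induct n) (simp_all add: D_add Dn_closed)

lemma Dn_Suc_mult:
  assumes "a \<in> carrier R" "b \<in> carrier R"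
  shows "(D ^^ Suc n) (a \<otimes> b) = (D ^^ n) (a \<otimes> D b) \<oplus> (D ^^ n) (D a \<otimes> b)"
  using assms by (simp add: funpow_Suc_right D_mult Dn_add D_closed del: funpow.simps)

text \<open>
  By the Leibniz rule the \<open>N\<close>-th derivative of \<open>a b\<close> is a combination of products of an \<open>i\<close>-th
  derivative of \<open>a\<close> and a \<open>j\<close>-th derivative of \<open>b\<close> with \<open>i + j = N < m + n\<close>, so \<open>i < m\<close> or \<open>j < n\<close>.
\<close>
lemma Dn_product_below:
  assumes "ideal P R" "a \<in> carrier R" "b \<in> carrier R"
    "\<And>i. i < m \<Longrightarrow> (D ^^ i) a \<in> P" "\<And>j. j < n \<Longrightarrow> (D ^^ j) b \<in> P" "N < m + n"
  shows "(D ^^ N) (a \<otimes> b) \<in> P"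
  using assms(2-)
proof (induct N arbitrary: a b m n)
  case 0
  interpret ideal P R by (rule assms(1))
  have "a \<in> P \<or> b \<in> P" using 0(3)[of 0] 0(4)[of 0] 0(5) by (cases m) auto
  then show ?case using 0(1,2) I_l_closed I_r_closed by auto
next
  case (Suc N)
  interpret ideal P R by (rule assms(1))
  have "(D ^^ N) (a \<otimes> D b) \<in> P"
  proof (rule Suc(1)[of a "D b" m "n - 1"])
    show "(D ^^ j) (D b) \<in> P" if "j < n - 1" for j
      using Suc(5)[of "Suc j"] that by (simp add: funpow_swap1)
  qed (use Suc D_closed in auto)
  moreover have "(D ^^ N) (D a \<otimes> b) \<in> P"
  proof (rule Suc(1)[of "D a" b "m - 1" n])
    show "(D ^^ j) (D a) \<in> P" if "j < m - 1" for j
      using Suc(4)[of "Suc j"] that by (simp add: funpow_swap1)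
  qed (use Suc D_closed in auto)
  ultimately show ?case using Dn_Suc_mult[OF Suc(2,3)] a_closed by simp
qed

text \<open>
  Modulo \<open>P\<close> only one term of the Leibniz expansion survives. Its coefficient \<open>k\<close> is the binomial
  coefficient \<open>m + n\<close> over \<open>m\<close>, but only its positivity matters, and that passes through Pascal's rule.
\<close>
lemma Dn_product_leading:
  assumes "ideal P R" "a \<in> carrier R" "b \<in> carrier R"
    "\<And>i. i < m \<Longrightarrow> (D ^^ i) a \<in> P" "\<And>j. j < n \<Longrightarrow> (D ^^ j) b \<in> P"
  shows "\<exists>k::nat. k > 0 \<and> (D ^^ (m + n)) (a \<otimes> b) \<ominus> add_pow R k ((D ^^ m) a \<otimes> (D ^^ n) b) \<in> P"
  using assms(2-)
proof (induct "m + n" arbitrary: a b m n)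
  case 0
  interpret ideal P R by (rule assms(1))
  have "a \<otimes> b \<ominus> a \<otimes> b \<in> P" using 0 by (simp add: minus_eq r_neg)
  then show ?case using 0 by (intro exI[of _ 1]) simp
next
  case (Suc N)
  interpret ideal P R by (rule assms(1))
  define L where "L = (D ^^ m) a \<otimes> (D ^^ n) b"
  have L: "L \<in> carrier R" unfolding L_def using Suc(3,4) Dn_closed by simp
  note IH = Suc.hyps(1) and N = Suc.hyps(2)
  note ab = Suc.prems
  have "\<exists>k::nat. (D ^^ N) (D a \<otimes> b) \<ominus> add_pow R k L \<in> P \<and> (m > 0 \<longrightarrow> k > 0)"
  proof (cases m)
    case 0
    have "(D ^^ N) (D a \<otimes> b) \<in> P"
      using Dn_product_below[OF assms(1), of "D a" b 0 n N] ab N 0 D_closed by auto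
    then show ?thesis using 0 by (intro exI[of _ 0]) (simp add: minus_eq)
  next
    case m: (Suc m')
    have "\<exists>k::nat. k > 0 \<and> (D ^^ (m' + n)) (D a \<otimes> b) \<ominus> add_pow R k ((D ^^ m') (D a) \<otimes> (D ^^ n) b) \<in> P"
    proof (rule IH)
      show "(D ^^ i) (D a) \<in> P" if "i < m'" for i
        using ab(3)[of "Suc i"] that m by (simp add: funpow_swap1)
    qed (use ab N m D_closed in auto)
    then show ?thesis using m N unfolding L_def by (auto simp: funpow_swap1)
  qed
  then obtain k :: nat where k: "(D ^^ N) (D a \<otimes> b) \<ominus> add_pow R k L \<in> P" "m > 0 \<longrightarrow> k > 0" by blast
  have "\<exists>k::nat. (D ^^ N) (a \<otimes> D b) \<ominus> add_pow R k L \<in> P \<and> (n > 0 \<longrightarrow> k > 0)"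
  proof (cases n)
    case 0
    have "(D ^^ N) (a \<otimes> D b) \<in> P"
      using Dn_product_below[OF assms(1), of a "D b" m 0 N] ab N 0 D_closed by auto
    then show ?thesis using 0 by (intro exI[of _ 0]) (simp add: minus_eq)
  next
    case n: (Suc n')
    have "\<exists>k::nat. k > 0 \<and> (D ^^ (m + n')) (a \<otimes> D b) \<ominus> add_pow R k ((D ^^ m) a \<otimes> (D ^^ n') (D b)) \<in> P"
    proof (rule IH)
      show "(D ^^ j) (D b) \<in> P" if "j < n'" for j
        using ab(4)[of "Suc j"] that n by (simp add: funpow_swap1)
    qed (use ab N n D_closed in auto)
    then show ?thesis using n N unfolding L_def by (auto simp: funpow_swap1)
  qed
  then obtain l :: nat where l: "(D ^^ N) (a \<otimes> D b) \<ominus> add_pow R l L \<in> P" "n > 0 \<longrightarrow> l > 0" by blast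
  have c: "(D ^^ N) (D a \<otimes> b) \<in> carrier R" "(D ^^ N) (a \<otimes> D b) \<in> carrier R"
    "add_pow R k L \<in> carrier R" "add_pow R l L \<in> carrier R"
    using ab L by (simp_all add: Dn_closed D_closed)
  have "(D ^^ (m + n)) (a \<otimes> b) \<ominus> add_pow R (k + l) L
      = ((D ^^ N) (a \<otimes> D b) \<oplus> (D ^^ N) (D a \<otimes> b)) \<ominus> (add_pow R k L \<oplus> add_pow R l L)"
    using Dn_Suc_mult[OF ab(1,2), of N] add.nat_pow_mult[OF L, of k l] N by simp
  also have "\<dots> = ((D ^^ N) (D a \<otimes> b) \<ominus> add_pow R k L) \<oplus> ((D ^^ N) (a \<otimes> D b) \<ominus> add_pow R l L)"
    using c by (simp add: minus_eq local.minus_add a_ac)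
  also have "\<dots> \<in> P" using a_closed k(1) l(1) by blast
  finally show ?case using k(2) l(2) N unfolding L_def by (intro exI[of _ "k + l"]) auto
qed

text \<open>
  For an ideal \<open>P\<close>, the largest ideal contained in \<open>P\<close> that is stable under \<open>D\<close>.
\<close>
definition differential_core :: "'a set \<Rightarrow> 'a set"
  where "differential_core P = {a \<in> carrier R. \<forall>n. (D ^^ n) a \<in> P}"

lemma differential_core_subset: "differential_core P \<subseteq> P"
  unfolding differential_core_def by (auto dest: spec[of _ 0])

lemma differential_core_greatest:
  assumes "J \<subseteq> P" "J \<subseteq> carrier R" "D ` J \<subseteq> J"
  shows "J \<subseteq> differential_core P"
proof -
  have "(D ^^ n) a \<in> J" if "a \<in> J" for a n
    using that assms(3) by (induct n) auto
  then show ?thesis using assms unfolding differential_core_def by blast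
qed

lemma differential_core_ideal:
  assumes "ideal P R" shows "ideal (differential_core P) R"
proof -
  interpret ideal P R by (rule assms)
  have neg: "(D ^^ n) (\<ominus> a) = \<ominus> (D ^^ n) a" if "a \<in> carrier R" for a n
    using that by (induct n) (simp_all add: D_uminus Dn_closed)
  have zero: "(D ^^ n) \<zero> = \<zero>" for n by (induct n) (simp_all add: D_zero)
  have mult: "x \<otimes> a \<in> differential_core P" if "a \<in> differential_core P" "x \<in> carrier R" for a x
  proof -
    have "(D ^^ n) (x \<otimes> a) \<in> P" for n
      using Dn_product_below[OF assms, of x a 0 "Suc n" n] that
      unfolding differential_core_def by auto
    then show ?thesis using that unfolding differential_core_def by simp
  qed
  show ?thesis
  proof (rule idealI)
    show "subgroup (differential_core P) (add_monoid R)"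
    proof (rule add.subgroupI)
      show "differential_core P \<subseteq> carrier R" unfolding differential_core_def by blast
      have "\<zero> \<in> differential_core P" unfolding differential_core_def by (simp add: zero)
      then show "differential_core P \<noteq> {}" by blast
      show "\<ominus> a \<in> differential_core P" if "a \<in> differential_core P" for a
        using that unfolding differential_core_def by (simp add: neg)
      show "a \<oplus> b \<in> differential_core P"
        if "a \<in> differential_core P" "b \<in> differential_core P" for a b
        using that unfolding differential_core_def by (simp add: Dn_add)
    qed
    show "x \<otimes> a \<in> differential_core P" if "a \<in> differential_core P" "x \<in> carrier R" for a x
      using mult that by blast
    show "a \<otimes> x \<in> differential_core P" if "a \<in> differential_core P" "x \<in> carrier R" for a x
      using mult[OF that] m_comm[of a x] that unfolding differential_core_def by simp
  qed (rule ring_axioms)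
qed

text \<open>
  If \<open>m\<close> and \<open>n\<close> are least such that the \<open>m\<close>-th derivative of \<open>a\<close> and the \<open>n\<close>-th derivative of
  \<open>b\<close> leave \<open>P\<close>, then by \<open>Dn_product_leading\<close> the \<open>(m + n)\<close>-th derivative of \<open>a b\<close> is, modulo \<open>P\<close>, a
  positive multiple of their product and leaves \<open>P\<close> as well.
\<close>
lemma differential_core_prime:
  assumes P: "primeideal P R"
    and torsion_free: "\<And>k x. \<lbrakk>k > (0::nat); x \<in> carrier R; add_pow R k x \<in> P\<rbrakk> \<Longrightarrow> x \<in> P"
  shows "differential_prime_ideal (differential_core P) R D"
proof -
  interpret primeideal P R by (rule P)
  note iP = is_ideal
  have "primeideal (differential_core P) R"
  proof (rule primeidealI[OF differential_core_ideal[OF iP] is_cring])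
    show "carrier R \<noteq> differential_core P"
      using I_notcarr a_subset differential_core_subset by blast
  next
    fix a b assume ab: "a \<in> carrier R" "b \<in> carrier R" "a \<otimes> b \<in> differential_core P"
    show "a \<in> differential_core P \<or> b \<in> differential_core P"
    proof (rule ccontr)
      assume "\<not> ?thesis"
      then have "\<exists>m. (D ^^ m) a \<notin> P" "\<exists>n. (D ^^ n) b \<notin> P"
        using ab unfolding differential_core_def by auto
      then obtain m n where m: "(D ^^ m) a \<notin> P" "\<And>i. i < m \<Longrightarrow> (D ^^ i) a \<in> P"
          and n: "(D ^^ n) b \<notin> P" "\<And>i. i < n \<Longrightarrow> (D ^^ i) b \<in> P"
        using exists_least_iff[of "\<lambda>m. (D ^^ m) a \<notin> P"] exists_least_iff[of "\<lambda>n. (D ^^ n) b \<notin> P"]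
        by auto
      define L where "L = (D ^^ m) a \<otimes> (D ^^ n) b"
      have L: "L \<in> carrier R" unfolding L_def using ab Dn_closed by simp
      obtain k :: nat where k: "k > 0" "(D ^^ (m + n)) (a \<otimes> b) \<ominus> add_pow R k L \<in> P"
        using Dn_product_leading[OF iP ab(1,2) m(2) n(2)] unfolding L_def by blast
      have x: "(D ^^ (m + n)) (a \<otimes> b) \<in> P" using ab(3) unfolding differential_core_def by blast
      have cancel: "v = u \<ominus> (u \<ominus> v)" if "u \<in> carrier R" "v \<in> carrier R" for u v
        using that by algebra
      have "add_pow R k L = (D ^^ (m + n)) (a \<otimes> b) \<ominus> ((D ^^ (m + n)) (a \<otimes> b) \<ominus> add_pow R k L)"
        by (rule cancel) (use L ab in \<open>simp_all add: Dn_closed\<close>)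
      also have "\<dots> \<in> P" using x k(2) by (simp add: minus_eq)
      finally have "L \<in> P" using torsion_free[OF k(1) L] by blast
      then show False using I_prime m(1) n(1) Dn_closed ab(1,2) unfolding L_def by blast
    qed
  qed
  moreover have "D ` differential_core P \<subseteq> differential_core P"
  proof
    fix y assume "y \<in> D ` differential_core P"
    then obtain a where a: "a \<in> carrier R" "\<forall>n. (D ^^ n) a \<in> P" "y = D a"
      unfolding differential_core_def by blast
    have "(D ^^ n) (D a) \<in> P" for n using a(2)[rule_format, of "Suc n"] by (simp add: funpow_swap1)
    then show "y \<in> differential_core P" using a D_closed unfolding differential_core_def by blast
  qed
  ultimately show ?thesis unfolding differential_prime_ideal_def by blast
qed

end

section \<open>Constants algebraic over the base field\<close>

context field
begin

text \<open>
  The minimal polynomial of \<open>c\<close> over \<open>K\<close> is irreducible and splits, hence it is linear.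
\<close>
lemma algebraic_over_algebraically_closed:
  assumes K: "K \<subseteq> carrier R" "algebraically_closed (R\<lparr>carrier := K\<rparr>)"
    and c: "c \<in> carrier R" "(algebraic over K) c"
  shows "c \<in> K"
proof -
  interpret K: algebraically_closed "R\<lparr>carrier := K\<rparr>" by (rule K(2))
  have sf: "subfield K R" using subfield_iff(1)[OF K.field_axioms K(1)] .
  note sr = subfieldE(1)[OF sf]
  define p where "p = Irr K c"
  have p: "p \<in> carrier (K[X])" "pirreducible K p" "lead_coeff p = \<one>" "eval p c = \<zero>"
    using IrrE[OF sf c] unfolding p_def by auto
  have cons: "univ_poly (R\<lparr>carrier := K\<rparr>) K = K[X]" using univ_poly_consistent[OF sr] by simp
  have pK: "p \<in> carrier (univ_poly (R\<lparr>carrier := K\<rparr>) (carrier (R\<lparr>carrier := K\<rparr>)))"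
    "ring_irreducible\<^bsub>univ_poly (R\<lparr>carrier := K\<rparr>) (carrier (R\<lparr>carrier := K\<rparr>))\<^esub> p"
    using p cons by simp_all
  have "degree p = 1"
    using K.pirreducible_imp_not_splitted[OF pK] K.roots_over_carrier[OF pK(1)] by blast
  then obtain a b where ab: "p = [a, b]"
    by (metis One_nat_def Suc_length_conv length_0_conv length_tl list.exhaust_sel list.sel(2) nat.distinct(1) list.size(3))
  have "a = \<one>" "b \<in> K" using p(1,3) ab unfolding univ_poly_carrier[symmetric] polynomial_def by auto
  moreover from this have "c \<oplus> b = \<zero>" using p(4) ab c(1) K(1) by auto
  ultimately have "\<ominus> b = c" using minus_equality[of c b] c(1) K(1) by auto
  then show ?thesis using subringE(5)[OF sr] \<open>b \<in> K\<close> by blast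
qed

lemma eval_map_derivation:
  assumes "differential_ring R D" "c \<in> carrier R" "D c = \<zero>" "set p \<subseteq> carrier R"
  shows "D (eval p c) = eval (map D p) c"
  using assms(4)
proof (induct p rule: rev_induct)
  case Nil
  interpret differential_ring R D by (rule assms(1))
  show ?case by (simp add: D_zero)
next
  case (snoc a p)
  interpret differential_ring R D by (rule assms(1))
  have p: "set p \<subseteq> carrier R" "a \<in> carrier R" using snoc(2) by auto
  have m: "set (map D p) \<subseteq> carrier R" "D a \<in> carrier R" using p D_closed by auto
  have e: "eval p c \<in> carrier R" "eval (map D p) c \<in> carrier R"
    using eval_in_carrier p(1) m(1) assms(2) by auto
  have "D (eval (p @ [a]) c) = eval (map D p) c \<otimes> c \<oplus> D a"
    using eval_append_aux[OF p assms(2)] e p(2) assms(2,3) snoc(1)[OF p(1)]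
    by (simp add: D_add D_mult)
  then show ?case using eval_append_aux[OF m assms(2)] by simp
qed

text \<open>
  As \<open>D c = 0\<close>, differentiating the coefficients of the monic minimal relation of \<open>c\<close> gives another
  relation. It is shorter because the derivative of the leading coefficient \<open>1\<close> vanishes, so it is
  trivial: all coefficients are constants.
\<close>
lemma constant_algebraic_over_constants:
  assumes D: "differential_ring R D" and F: "subfield F R" "D ` F \<subseteq> F"
    and c: "c \<in> carrier R" "D c = \<zero>" "(algebraic over F) c"
  shows "(algebraic over {a \<in> F. D a = \<zero>}) c"
proof -
  interpret differential_ring R D by (rule D)
  note sr = subfieldE(1)[OF F(1)]
  obtain a r where ar: "a \<in> F" "a \<noteq> \<zero>" "set r \<subseteq> F" "eval (a # r) c = \<zero>"
    and min: "\<And>q. \<lbrakk>set q \<subseteq> F; length q \<le> length r; eval q c = \<zero>\<rbrakk> \<Longrightarrow> set q \<subseteq> {\<zero>}"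
    using minimal_relation[OF sr c(1,3)] by metis
  have i: "inv a \<in> F" "inv a \<otimes> a = \<one>" using subfield_m_inv[OF F(1), of a] ar by auto
  have Fc: "F \<subseteq> carrier R" using subringE(1)[OF sr] .
  define q where "q = map ((\<otimes>) (inv a)) r"
  have q: "set q \<subseteq> F" "set q \<subseteq> carrier R"
    using subringE(6)[OF sr i(1)] ar(3) Fc unfolding q_def by auto
  have oq: "eval (\<one> # q) c = \<zero>"
    using eval_map_mult[of "a # r" "inv a" c] ar i Fc c(1) unfolding q_def by auto
  have oq': "set (\<one> # q) \<subseteq> carrier R" using q by simp
  have qD: "set (map D q) \<subseteq> carrier R" using q(2) D_closed by auto
  have "eval (map D (\<one> # q)) c = \<zero>"
    using eval_map_derivation[OF D c(1,2) oq'] oq D_zero by simp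
  then have "eval (map D q) c = \<zero>"
    using eval_in_carrier[OF qD c(1)] c(1) by (simp add: D_one)
  then have "set (map D q) \<subseteq> {\<zero>}"
    using min[of "map D q"] q(1) F(2) unfolding q_def by auto
  then have "set (\<one> # q) \<subseteq> {a \<in> F. D a = \<zero>}" using q(1) D_one subringE(3)[OF sr] by auto
  then have "polynomial {a \<in> F. D a = \<zero>} (\<one> # q)"
    unfolding polynomial_def using one_not_zero by simp
  then show ?thesis using algebraicI[OF _ _ oq] unfolding univ_poly_carrier by blast
qed

section \<open>Reduction to relative dimension one\<close>

definition maximal_transcendental_subring :: "'a set \<Rightarrow> 'a \<Rightarrow> 'a set \<Rightarrow> bool"
  where "maximal_transcendental_subring B c A \<longleftrightarrow>
    subring A R \<and> A \<subseteq> B \<and> (transcendental over A) c \<and>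
    (\<forall>A'. subring A' R \<and> A \<subseteq> A' \<and> A' \<subseteq> B \<and> (transcendental over A') c \<longrightarrow> A' = A)"

lemma exists_maximal_transcendental_subring:
  assumes F: "subring F R" "F \<subseteq> B" and c: "c \<in> carrier R" "(transcendental over F) c"
  obtains A where "F \<subseteq> A" "maximal_transcendental_subring B c A"
proof -
  let ?I = "{A. subring A R \<and> F \<subseteq> A \<and> A \<subseteq> B \<and> (transcendental over A) c}"
  have "\<exists>M\<in>?I. \<forall>A\<in>?I. M \<subseteq> A \<longrightarrow> A = M"
  proof (rule subset_Zorn_nonempty)
    show "?I \<noteq> {}" using F c by blast
  next
    fix C assume C: "C \<noteq> {}" "subset.chain ?I C"
    have mem: "subring A R" "F \<subseteq> A" "A \<subseteq> B" "(transcendental over A) c" if "A \<in> C" for A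
      using C(2) that unfolding subset.chain_def by auto
    have fin: "\<exists>A\<in>C. Y \<subseteq> A" if "finite Y" "Y \<subseteq> \<Union>C" for Y
      using finite_subset_Union_chain[OF that C(1,2)] by metis
    have "subring (\<Union>C) R"
    proof (rule subringI)
      show "\<Union>C \<subseteq> carrier R" using subringE(1)[OF mem(1)] by blast
      show "\<one> \<in> \<Union>C" using subringE(3)[OF mem(1)] C(1) by blast
      show "\<ominus> h \<in> \<Union>C" if "h \<in> \<Union>C" for h using subringE(5)[OF mem(1)] that by blast
      fix h1 h2 assume "h1 \<in> \<Union>C" "h2 \<in> \<Union>C"
      then obtain A where A: "A \<in> C" "h1 \<in> A" "h2 \<in> A" using fin[of "{h1, h2}"] by auto
      show "h1 \<otimes> h2 \<in> \<Union>C" "h1 \<oplus> h2 \<in> \<Union>C"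
        using subringE(6,7)[OF mem(1)[OF A(1)] A(2,3)] A(1) by auto
    qed
    moreover have "(transcendental over (\<Union>C)) c"
    proof (rule ccontr)
      assume "\<not> ?thesis"
      then have "(algebraic over (\<Union>C)) c" by (simp add: over_def)
      then obtain p where p: "set p \<subseteq> \<Union>C" "\<not> set p \<subseteq> {\<zero>}" "eval p c = \<zero>"
        using algebraic_iff_relation[OF \<open>subring (\<Union>C) R\<close> c(1)] by blast
      obtain A where A: "A \<in> C" "set p \<subseteq> A" using fin[of "set p"] p(1) by auto
      then show False using transcendentalD[OF mem(1)[OF A(1)] c(1) mem(4)[OF A(1)] A(2) p(3)] p(2) by blast
    qed
    ultimately show "\<Union>C \<in> ?I" using C(1) mem(2,3) by blast
  qed
  then obtain A where A: "A \<in> ?I" and max: "\<forall>A'\<in>?I. A \<subseteq> A' \<longrightarrow> A' = A" by blast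
  have "A' = A" if "subring A' R" "A \<subseteq> A'" "A' \<subseteq> B" "(transcendental over A') c" for A'
    using max A that by blast
  then have "maximal_transcendental_subring B c A"
    using A unfolding maximal_transcendental_subring_def by blast
  then show thesis using A that by blast
qed

text \<open>
  If \<open>u \<in> B - A\<close>, then \<open>c\<close> is algebraic over \<open>A[u]\<close> by maximality. Exchange makes \<open>u\<close> algebraic over
  \<open>A[c]\<close>, which gives the first claim; the second follows by transitivity through \<open>A[u, c]\<close>.
\<close>
lemma algebraic_over_maximal_subring:
  assumes M: "maximal_transcendental_subring B c A" and c: "c \<in> carrier R"
    and B: "subring B R" "carrier R \<subseteq> fractions B"
  shows "carrier R \<subseteq> algebraics_over (simple_extension A c)"
    and "\<And>u. \<lbrakk>u \<in> B; u \<notin> A\<rbrakk> \<Longrightarrow> carrier R \<subseteq> algebraics_over (simple_extension A u)"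
proof -
  have A: "subring A R" "A \<subseteq> B" and tc: "(transcendental over A) c"
    and max: "\<And>A'. \<lbrakk>subring A' R; A \<subseteq> A'; A' \<subseteq> B; (transcendental over A') c\<rbrakk> \<Longrightarrow> A' = A"
    using M unfolding maximal_transcendental_subring_def by blast+
  have Bc: "B \<subseteq> carrier R" using subringE(1)[OF B(1)] .
  have Ac: "A \<subseteq> carrier R" using subringE(1)[OF A(1)] .
  have sr: "subring (simple_extension A e) R" "A \<subseteq> simple_extension A e" "e \<in> simple_extension A e"
    if "e \<in> carrier R" for e
    using that simple_extension_is_subring[OF A(1)] simple_extension_incl[OF Ac] simple_extension_mem[OF A(1)] by auto
  have alg: "(algebraic over (simple_extension A e)) c" if e: "e \<in> B" "e \<notin> A" for e
  proof -
    have ec: "e \<in> carrier R" using e Bc by blast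
    have "simple_extension A e \<noteq> A" using e sr(3)[OF ec] by blast
    then show ?thesis
      using max[OF sr(1,2)[OF ec] simple_extension_subring_incl[OF B(1) A(2) e(1)]] by (auto simp: over_def)
  qed
  let ?K = "algebraics_over (simple_extension A c)"
  have K: "subfield ?K R" by (rule algebraics_over_subfield[OF sr(1)[OF c]])
  have BK: "B \<subseteq> ?K"
  proof
    fix e assume e: "e \<in> B"
    then have ec: "e \<in> carrier R" using Bc by blast
    show "e \<in> ?K"
    proof (cases "e \<in> A")
      case True
      then show ?thesis using subset_algebraics_over[OF sr(1)[OF c]] sr(2)[OF c] by blast
    next
      case False
      then show ?thesis
        using alg[OF e False] transcendental_exchange[OF A(1) c ec tc] ec
        unfolding algebraics_over_def by (auto simp: over_def)
    qed
  qed
  show first: "carrier R \<subseteq> ?K"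
  proof
    fix e assume "e \<in> carrier R"
    then obtain a b where ab: "a \<in> B" "b \<in> B" "b \<noteq> \<zero>" "e \<in> carrier R" "b \<otimes> e = a"
      using fractionsE[OF B(1)] B(2) by (metis subsetD)
    then show "e \<in> ?K" using subfield_m_inv_simprule[OF K, of b e] BK by auto
  qed
  fix u assume u: "u \<in> B" "u \<notin> A"
  then have uc: "u \<in> carrier R" using Bc by blast
  let ?L = "algebraics_over (simple_extension A u)"
  have L: "subfield ?L R" by (rule algebraics_over_subfield[OF sr(1)[OF uc]])
  have "c \<in> ?L" using alg[OF u] c unfolding algebraics_over_def by blast
  moreover have "A \<subseteq> ?L" using subset_algebraics_over[OF sr(1)[OF uc]] sr(2)[OF uc] by blast
  ultimately have "simple_extension A c \<subseteq> ?L"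
    using simple_extension_subring_incl[OF subfieldE(1)[OF L]] by blast
  then show "carrier R \<subseteq> ?L"
    using algebraic_trans[OF sr(1)[OF uc] _ sr(1)[OF c]] first by blast
qed

text \<open>
  A relation for \<open>y\<close> over \<open>A[u]\<close> may be divided by \<open>u\<close> until some coefficient has a nonzero constant
  term. Then \<open>l\<close>, the list of constant terms, is a nontrivial relation for \<open>y\<close> modulo every ideal
  containing \<open>u\<close>.
\<close>
lemma relation_reduced_modulo:
  assumes A: "subring A R" and u: "u \<in> carrier R" "u \<noteq> \<zero>"
    and y: "y \<in> carrier R" "(algebraic over (simple_extension A u)) y"
  obtains k l where "set k \<subseteq> simple_extension A u" "set l \<subseteq> A" "\<not> set l \<subseteq> {\<zero>}"
    "eval k y \<otimes> u \<oplus> eval l y = \<zero>"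
proof -
  let ?S = "simple_extension A u"
  have S: "subring ?S R" using simple_extension_is_subring[OF A u(1)] .
  have Sc: "?S \<subseteq> carrier R" and Ac: "A \<subseteq> carrier R" using subringE(1)[OF S] subringE(1)[OF A] by auto
  have main: "eval p y = \<zero> \<and> \<not> set p \<subseteq> {\<zero>} \<longrightarrow> (\<exists>k l. set k \<subseteq> ?S \<and> set l \<subseteq> A \<and>
      \<not> set l \<subseteq> {\<zero>} \<and> eval k y \<otimes> u \<oplus> eval l y = \<zero>)" (is "_ \<longrightarrow> ?reduced")
    if "set p \<subseteq> ?S" for p
    using A u(1) that
  proof (rule simple_extension_list_induct)
    fix p k l
    assume k: "\<And>x. x \<in> set p \<Longrightarrow> k x \<in> ?S" and l: "\<And>x. x \<in> set p \<Longrightarrow> l x \<in> A"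
      and kl: "\<And>x. x \<in> set p \<Longrightarrow> x = k x \<otimes> u \<oplus> l x"
      and IH: "eval (map k p) y = \<zero> \<and> \<not> set (map k p) \<subseteq> {\<zero>} \<longrightarrow> ?reduced"
    have klc: "k x \<in> carrier R \<and> l x \<in> carrier R" if "x \<in> set p" for x
      using k[OF that] l[OF that] Sc Ac by blast
    have mk: "set (map k p) \<subseteq> ?S" and ml: "set (map l p) \<subseteq> A" using k l by auto
    show "eval p y = \<zero> \<and> \<not> set p \<subseteq> {\<zero>} \<longrightarrow> ?reduced"
    proof (intro impI, elim conjE)
      assume z: "eval p y = \<zero>" and nz: "\<not> set p \<subseteq> {\<zero>}"
      have "map (\<lambda>x. k x \<otimes> u \<oplus> l x) p = p" by (rule map_idI) (rule kl[symmetric])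
      then have sum: "eval (map k p) y \<otimes> u \<oplus> eval (map l p) y = \<zero>"
        using eval_map_linear[where p = p and k = k and l = l, OF klc u(1) y(1)] z by simp
      show ?reduced
      proof (cases "set (map l p) \<subseteq> {\<zero>}")
        case False
        then show ?thesis using mk ml sum by blast
      next
        \<comment> \<open>Every coefficient is a multiple of \<open>u\<close>, which cancels from the relation.\<close>
        case True
        have ec: "eval (map k p) y \<in> carrier R"
          using eval_in_carrier[OF subset_trans[OF mk Sc] y(1)] .
        then have "eval (map k p) y \<otimes> u = \<zero>" using sum eval_zero_list[OF True y(1)] u(1) by simp
        then have "eval (map k p) y = \<zero>" using integral_iff ec u by blast
        moreover have "\<not> set (map k p) \<subseteq> {\<zero>}"
        proof
          assume kz: "set (map k p) \<subseteq> {\<zero>}"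
          have "x = \<zero>" if "x \<in> set p" for x
          proof -
            have "k x = \<zero>" "l x = \<zero>" using True kz that by auto
            then have "k x \<otimes> u \<oplus> l x = \<zero>" using u(1) by simp
            with kl[OF that] show ?thesis by (rule trans)
          qed
          then show False using nz by blast
        qed
        ultimately show ?thesis using IH by blast
      qed
    qed
  qed blast
  obtain p where "set p \<subseteq> ?S" "\<not> set p \<subseteq> {\<zero>}" "eval p y = \<zero>"
    using algebraic_iff_relation[OF S y(1)] y(2) by blast
  then show thesis using main that by blast
qed

text \<open>
  Since \<open>q\<close> is prime and \<open>y \<notin> q\<close>, vanishing low-order coefficients of \<open>l\<close> can be divided out
  modulo \<open>q\<close>. The first nonzero one is congruent to a multiple of \<open>y \<in> Q\<close> modulo \<open>q \<subseteq> Q\<close>.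
\<close>
lemma strict_prime_inclusion_imp_meets:
  assumes A: "subring A R" "A \<subseteq> B" and B: "subring B R"
    and q: "primeideal q (R\<lparr>carrier := B\<rparr>)" and Q: "ideal Q (R\<lparr>carrier := B\<rparr>)" "q \<subseteq> Q"
    and y: "y \<in> Q" "y \<notin> q" and l: "set l \<subseteq> A" "\<not> set l \<subseteq> {\<zero>}" "eval l y \<in> q"
  shows "\<exists>a\<in>A. a \<noteq> \<zero> \<and> a \<in> Q"
  using l
proof (induct l rule: rev_induct)
  case (snoc a p)
  interpret q: primeideal q "R\<lparr>carrier := B\<rparr>" by (rule q)
  interpret Q: ideal Q "R\<lparr>carrier := B\<rparr>" by (rule Q(1))
  have Bc: "B \<subseteq> carrier R" using subringE(1)[OF B] .
  have yB: "y \<in> B" "y \<in> carrier R" using y(1) Q.a_subset Bc by auto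
  have p: "set p \<subseteq> A" "a \<in> A" "set p \<subseteq> B" "set p \<subseteq> carrier R" "a \<in> carrier R" "a \<in> B"
    using snoc(2) A(2) Bc by auto
  have e: "eval p y \<in> B" "eval p y \<in> carrier R"
    using eval_in_subring[OF B p(3) yB(1)] Bc by auto
  have eq: "eval (p @ [a]) y = eval p y \<otimes> y \<oplus> a" using eval_append_aux[OF p(4,5) yB(2)] .
  show ?case
  proof (cases "a = \<zero>")
    case True
    then have "eval p y \<otimes> y \<in> q" using snoc(4) eq e(2) yB(2) by simp
    then have "eval p y \<in> q" using q.I_prime[of "eval p y" y] e(1) yB(1) y(2) by auto
    then show ?thesis using snoc(1)[OF p(1)] snoc(3) True by auto
  next
    case False
    have eyQ: "eval p y \<otimes> y \<in> Q" using Q.I_l_closed[OF y(1), of "eval p y"] e(1) by simp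
    then have n: "\<ominus> (eval p y \<otimes> y) \<in> Q"
      using Q.I_l_closed[of "eval p y \<otimes> y" "\<ominus> \<one>"] subringE(3,5)[OF B] e(2) yB(2) by (simp add: l_minus)
    have "a = \<ominus> (eval p y \<otimes> y) \<oplus> (eval p y \<otimes> y \<oplus> a)" using e(2) yB(2) p(5) by algebra
    also have "\<dots> \<in> Q" using Q.a_closed[OF n, of "eval p y \<otimes> y \<oplus> a"] snoc(4) eq Q(2) by auto
    finally show ?thesis using False p(2) by blast
  qed
qed simp

text \<open>
  Relative to \<open>A\<close> the ring \<open>B\<close> has dimension one, so primes that miss \<open>A - {\<zero>}\<close> behave as in a
  one-dimensional domain.
\<close>
lemma prime_below_disjoint_ideal:
  assumes M: "maximal_transcendental_subring B c A" and c: "c \<in> carrier R"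
    and B: "subring B R" "carrier R \<subseteq> fractions B"
    and Q: "ideal Q (R\<lparr>carrier := B\<rparr>)" "Q \<inter> A \<subseteq> {\<zero>}"
    and q: "primeideal q (R\<lparr>carrier := B\<rparr>)" "q \<subset> Q"
  shows "q = {\<zero>}"
proof (rule ccontr)
  have A: "subring A R" "A \<subseteq> B" using M unfolding maximal_transcendental_subring_def by auto
  interpret q: primeideal q "R\<lparr>carrier := B\<rparr>" by (rule q(1))
  interpret Q: ideal Q "R\<lparr>carrier := B\<rparr>" by (rule Q(1))
  have Bc: "B \<subseteq> carrier R" using subringE(1)[OF B(1)] .
  assume "q \<noteq> {\<zero>}"
  moreover have "\<zero> \<in> q" using additive_subgroup.zero_closed[OF q.additive_subgroup_axioms] by simp
  ultimately obtain u where u: "u \<in> q" "u \<noteq> \<zero>" by blast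
  obtain y where y: "y \<in> Q" "y \<notin> q" using q(2) by blast
  have uB: "u \<in> B" "u \<notin> A" "u \<in> carrier R" using u q(2) Q(2) q.a_subset Bc by auto
  have yB: "y \<in> B" "y \<in> carrier R" using y Q.a_subset Bc by auto
  have "y \<in> algebraics_over (simple_extension A u)"
    using algebraic_over_maximal_subring(2)[OF M c B uB(1,2)] yB(2) by blast
  then have "(algebraic over (simple_extension A u)) y" unfolding algebraics_over_def by blast
  then obtain k l where kl: "set k \<subseteq> simple_extension A u" "set l \<subseteq> A" "\<not> set l \<subseteq> {\<zero>}"
    "eval k y \<otimes> u \<oplus> eval l y = \<zero>"
    using relation_reduced_modulo[OF A(1) uB(3) u(2) yB(2)] by metis
  have "set k \<subseteq> B" using kl(1) simple_extension_subring_incl[OF B(1) A(2) uB(1)] by blast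
  then have e: "eval k y \<in> B" "eval k y \<in> carrier R" "eval l y \<in> B" "eval l y \<in> carrier R"
    using eval_in_subring[OF B(1) _ yB(1)] kl(2) A(2) Bc by auto
  have "\<ominus> (eval k y) \<otimes> u \<in> q" using q.I_l_closed[OF u(1), of "\<ominus> (eval k y)"] subringE(5)[OF B(1) e(1)] by simp
  moreover have "eval l y = \<ominus> (eval k y) \<otimes> u"
    using minus_equality[of "eval l y" "eval k y \<otimes> u"] kl(4) e uB(3) by (simp add: a_comm l_minus)
  ultimately have "eval l y \<in> q" by simp
  then show False
    using strict_prime_inclusion_imp_meets[OF A B(1) q(1) Q(1) _ y kl(2,3)] q(2) Q(2) by blast
qed

section \<open>Primes over the specializations of a transcendental constant\<close>

text \<open>
  As \<open>c\<close> is transcendental, the given equation is an identity between polynomials over \<open>A\<close>, which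
  may be evaluated at \<open>\<alpha>\<close> instead of \<open>c\<close>.
\<close>
lemma evaluation_specialization:
  assumes A: "subring A R" and c: "c \<in> carrier R" "(transcendental over A) c"
    and h: "h \<in> carrier (A[X])" and \<alpha>: "\<alpha> \<in> A" and b: "b \<in> A" and s: "s \<in> simple_extension A c"
    and eq: "(c \<ominus> \<alpha>) \<otimes> s = b \<otimes> eval h c [^] (l::nat)"
  shows "b \<otimes> eval h \<alpha> [^] l = \<zero>"
proof -
  have ac: "\<alpha> \<in> carrier R" "b \<in> carrier R" using \<alpha> b subringE(1)[OF A] by auto
  interpret P: ring "A[X]" using univ_poly_is_ring[OF A] .
  interpret ec: ring_hom_ring "A[X]" R "\<lambda>p. eval p c" by (rule eval_ring_hom[OF A c(1)])
  interpret ea: ring_hom_ring "A[X]" R "\<lambda>p. eval p \<alpha>" by (rule eval_ring_hom[OF A ac(1)])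
  obtain p where p: "p \<in> carrier (A[X])" "s = eval p c"
    using s simple_extension_as_eval_img[OF subringE(1)[OF A] c(1)] by auto
  define m where "m = [\<one>, \<ominus> \<alpha>]"
  define k where "k = poly_of_const b"
  have m: "m \<in> carrier (A[X])" "\<And>x. x \<in> carrier R \<Longrightarrow> eval m x = x \<ominus> \<alpha>"
    using subringE(3,5)[OF A] \<alpha> ac one_not_zero
    unfolding m_def univ_poly_carrier[symmetric] polynomial_def by (auto simp: minus_eq)
  have k: "k \<in> carrier (A[X])" "\<And>x. x \<in> carrier R \<Longrightarrow> eval k x = b"
    using b ac(2) unfolding k_def poly_of_const_def univ_poly_carrier[symmetric] polynomial_def by auto
  have hl: "h [^]\<^bsub>A[X]\<^esub> l \<in> carrier (A[X])" using h by simp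
  have "eval (m \<otimes>\<^bsub>A[X]\<^esub> p) c = eval (k \<otimes>\<^bsub>A[X]\<^esub> h [^]\<^bsub>A[X]\<^esub> l) c"
    using ec.hom_mult[OF m(1) p(1)] ec.hom_mult[OF k(1) hl] ec.hom_nat_pow[OF h, of l]
      m(2)[OF c(1)] k(2)[OF c(1)] eq p(2) by simp
  moreover have "inj_on (\<lambda>p. eval p c) (carrier (A[X]))"
    using c(2) unfolding over_def transcendental_def .
  ultimately have "m \<otimes>\<^bsub>A[X]\<^esub> p = k \<otimes>\<^bsub>A[X]\<^esub> h [^]\<^bsub>A[X]\<^esub> l"
    using inj_onD[of "\<lambda>p. eval p c" "carrier (A[X])"] P.m_closed[OF m(1) p(1)] P.m_closed[OF k(1) hl] by blast
  then have "(\<alpha> \<ominus> \<alpha>) \<otimes> eval p \<alpha> = b \<otimes> eval h \<alpha> [^] l"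
    using ea.hom_mult[OF m(1) p(1)] ea.hom_mult[OF k(1) hl] ea.hom_nat_pow[OF h, of l]
      m(2)[OF ac(1)] k(2)[OF ac(1)] by simp
  moreover have "(\<alpha> \<ominus> \<alpha>) \<otimes> eval p \<alpha> = \<zero>" using ac(1) p(1) by (simp add: minus_eq r_neg)
  ultimately show ?thesis by simp
qed

text \<open>
  The zeros of \<open>h\<close> are the finitely many values \<open>\<alpha>\<close> of \<open>c\<close> that may be missed outside the zeros of
  \<open>g\<close>: this is the part of Chevalley's theorem on images of morphisms that is needed.
\<close>
lemma exists_prime_over_specialization:
  assumes A: "subring A R" and xs: "set xs \<subseteq> carrier R" and B: "B = finite_extension A xs"
    and frac: "carrier R \<subseteq> fractions B"
    and c: "c \<in> carrier R" "(transcendental over A) c"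
    and alg: "carrier R \<subseteq> algebraics_over (simple_extension A c)"
    and g: "g \<in> B" "g \<noteq> \<zero>" "g \<otimes> c \<in> B"
  obtains h where "h \<in> carrier (A[X])" "h \<noteq> []"
    "\<And>\<alpha>. \<lbrakk>\<alpha> \<in> A; eval h \<alpha> \<noteq> \<zero>\<rbrakk> \<Longrightarrow>
      \<exists>Q. primeideal Q (R\<lparr>carrier := B\<rparr>) \<and> (c \<ominus> \<alpha>) \<otimes> g \<in> Q \<and> g \<notin> Q \<and> Q \<inter> A \<subseteq> {\<zero>}"
proof -
  note Ac = subringE(1)[OF A]
  have Bs: "subring B R" "A \<subseteq> B"
    using finite_extension_is_subring[OF A xs] finite_extension_incl[OF Ac xs] unfolding B by auto
  note Bc = subringE(1)[OF Bs(1)]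
  let ?A1 = "simple_extension A c"
  have A1: "subring ?A1 R" "A \<subseteq> ?A1" "c \<in> ?A1"
    using simple_extension_is_subring[OF A c(1)] simple_extension_incl[OF Ac c(1)]
      simple_extension_mem[OF A c(1)] by auto
  have incl: "B \<subseteq> finite_extension ?A1 xs" unfolding B by (rule mono_finite_extension[OF A1(2)])
  have "g \<in> finite_extension ?A1 xs" using g(1) incl by blast
  then obtain v where v: "v \<in> ?A1" "v \<noteq> \<zero>"
    and desc: "\<And>w b s k. \<lbrakk>w \<in> ?A1; b \<in> ?A1; s \<in> finite_extension ?A1 xs; w \<otimes> s = b \<otimes> g [^] (k::nat)\<rbrakk>
        \<Longrightarrow> \<exists>l::nat. \<exists>s\<in>?A1. w \<otimes> s = b \<otimes> v [^] l"
    using divisibility_descent[OF A1(1) xs alg _ g(2)] by metis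
  obtain h where h: "h \<in> carrier (A[X])" "v = eval h c"
    using v(1) simple_extension_as_eval_img[OF Ac c(1)] by auto
  have "h \<noteq> []" using h v(2) by auto
  have hc: "set h \<subseteq> carrier R"
    using polynomial_incl[of A h] h(1) Ac unfolding univ_poly_carrier by blast
  have "\<exists>Q. primeideal Q (R\<lparr>carrier := B\<rparr>) \<and> (c \<ominus> \<alpha>) \<otimes> g \<in> Q \<and> g \<notin> Q \<and> Q \<inter> A \<subseteq> {\<zero>}"
    if \<alpha>: "\<alpha> \<in> A" "eval h \<alpha> \<noteq> \<zero>" for \<alpha>
  proof -
    interpret S: domain "R\<lparr>carrier := B\<rparr>" by (rule subring_is_domain[OF Bs(1)])
    define e where "e = (c \<ominus> \<alpha>) \<otimes> g"
    have car: "\<alpha> \<in> carrier R" "g \<in> carrier R" "\<alpha> \<in> B" "eval h \<alpha> \<in> carrier R"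
      using \<alpha> g(1) Ac Bs(2) Bc eval_in_carrier[OF hc, of \<alpha>] by auto
    have "e = g \<otimes> c \<oplus> \<ominus> (\<alpha> \<otimes> g)" using car c(1) unfolding e_def by algebra
    then have e: "e \<in> B" using subringE(5-7)[OF Bs(1)] g car(3) by simp
    \<comment> \<open>Avoiding this multiplicative set keeps both \<open>g\<close> and \<open>A - {\<zero>}\<close> outside \<open>Q\<close>.\<close>
    let ?T = "{a \<otimes> g [^] (k::nat) | a k. a \<in> A - {\<zero>}}"
    let ?J = "PIdl\<^bsub>R\<lparr>carrier := B\<rparr>\<^esub> e"
    have J: "ideal ?J (R\<lparr>carrier := B\<rparr>)" using S.cgenideal_ideal e by simp
    have gk: "g [^] k \<in> B" for k :: nat using nat_pow_in_subring[OF Bs(1) g(1)] .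
    have T: "a \<otimes> g [^] (k::nat) \<in> ?T" if "a \<in> A" "a \<noteq> \<zero>" for a k using that by blast
    have T1: "?T \<subseteq> B" using subringE(6)[OF Bs(1)] gk Bs(2) by blast
    have T2: "\<one> \<in> ?T" using T[of \<one> 0] subringE(3)[OF A] one_not_zero by simp
    have T3: "s \<otimes> t \<in> ?T" if s: "s \<in> ?T" and t: "t \<in> ?T" for s t
    proof -
      from s obtain a and k :: nat where s': "s = a \<otimes> g [^] k" "a \<in> A" "a \<noteq> \<zero>" by blast
      from t obtain a' and k' :: nat where t': "t = a' \<otimes> g [^] k'" "a' \<in> A" "a' \<noteq> \<zero>" by blast
      note st = s'(1) t'(1) s'(2) t'(2) s'(3) t'(3)
      have ac: "a \<in> carrier R" "a' \<in> carrier R" using st(3,4) Ac by auto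
      have "s \<otimes> t = (a \<otimes> a') \<otimes> g [^] (k + k')"
        unfolding st(1,2) nat_pow_mult[OF car(2), symmetric] using ac car(2) by (simp add: m_ac)
      then show ?thesis using T[of "a \<otimes> a'" "k + k'"] subringE(6)[OF A st(3,4)] integral_iff ac st(5,6) by auto
    qed
    have "?J \<inter> ?T = {}"
    proof (rule ccontr)
      assume "?J \<inter> ?T \<noteq> {}"
      then obtain x a and k :: nat where x: "x \<in> B" "a \<in> A" "a \<noteq> \<zero>" "x \<otimes> e = a \<otimes> g [^] k"
        unfolding cgenideal_def by auto
      have xc: "x \<in> carrier R" "a \<in> carrier R" using x Bc Ac by auto
      have eq: "(c \<ominus> \<alpha>) \<otimes> (g \<otimes> x) = a \<otimes> g [^] k"
        using xc car c(1) x(4) unfolding e_def by (simp add: m_ac)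
      have w: "c \<ominus> \<alpha> \<in> ?A1" using subringE(5,7)[OF A1(1)] A1(2,3) \<alpha>(1) unfolding minus_eq by blast
      have gx: "g \<otimes> x \<in> finite_extension ?A1 xs" using subringE(6)[OF Bs(1) g(1) x(1)] incl by blast
      from desc[OF w subsetD[OF A1(2) x(2)] gx eq] obtain l :: nat and s
        where s: "s \<in> ?A1" "(c \<ominus> \<alpha>) \<otimes> s = a \<otimes> v [^] l" by blast
      have "a \<otimes> eval h \<alpha> [^] l = \<zero>"
        using evaluation_specialization[OF A c h(1) \<alpha>(1) x(2) s(1)] s(2) h(2) by simp
      moreover have "eval h \<alpha> [^] l \<noteq> \<zero>"
        using \<alpha>(2) car(4) by (induct l) (auto simp: integral_iff)
      ultimately show False using integral_iff xc(2) x(3) car(4) by auto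
    qed
    then obtain Q where Q: "primeideal Q (R\<lparr>carrier := B\<rparr>)" "?J \<subseteq> Q" "Q \<inter> ?T = {}"
      using S.exists_primeideal_disjoint[OF J, of ?T] T1 T2 T3 by auto
    have "e \<in> Q" using S.cgenideal_self[of e] e Q(2) by auto
    moreover have "g \<in> ?T"
      using T[of \<one> 1] subringE(3)[OF A] one_not_zero nat_pow_eone[OF car(2)] car(2) by simp
    then have "g \<notin> Q" using Q(3) by blast
    moreover have "Q \<inter> A \<subseteq> {\<zero>}"
    proof
      fix a assume a: "a \<in> Q \<inter> A"
      have "a \<otimes> g [^] (0::nat) = a" using a Ac by auto
      then have "a \<noteq> \<zero> \<Longrightarrow> a \<in> ?T" using T[of a 0] a by simp
      then show "a \<in> {\<zero>}" using Q(3) a by blast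
    qed
    ultimately show ?thesis using Q(1) unfolding e_def by blast
  qed
  then show thesis using that h(1) \<open>h \<noteq> []\<close> by blast
qed

text \<open>
  The ideal \<open>B \<inter> d B\<close> is stable under \<open>D\<close> since \<open>d\<close> is a constant, and it is contained in \<open>Q\<close>: if
  \<open>r = d s\<close>, then \<open>g r = s (d g) \<in> Q\<close> while \<open>g \<notin> Q\<close>. So the differential core of \<open>Q\<close> is a nonzero
  prime contained in \<open>Q\<close>, which leaves only \<open>Q\<close> itself.
\<close>
lemma minimal_nonzero_prime_differential:
  assumes D: "differential_ring R D" "differential_ring (R\<lparr>carrier := B\<rparr>) D" and B: "subring B R"
    and d: "d \<in> carrier R" "D d = \<zero>"
    and Q: "primeideal Q (R\<lparr>carrier := B\<rparr>)" "d \<otimes> g \<in> Q" "d \<otimes> g \<noteq> \<zero>"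
    and g: "g \<in> B" "g \<notin> Q"
    and below: "\<And>q. \<lbrakk>primeideal q (R\<lparr>carrier := B\<rparr>); q \<subset> Q\<rbrakk> \<Longrightarrow> q = {\<zero>}"
    and torsion_free: "\<And>k x. \<lbrakk>k > (0::nat); x \<in> B; add_pow (R\<lparr>carrier := B\<rparr>) k x \<in> Q\<rbrakk> \<Longrightarrow> x \<in> Q"
  shows "differential_prime_ideal Q (R\<lparr>carrier := B\<rparr>) D"
proof -
  interpret dR: differential_ring R D by (rule D(1))
  interpret dB: differential_ring "R\<lparr>carrier := B\<rparr>" D by (rule D(2))
  interpret Q: primeideal Q "R\<lparr>carrier := B\<rparr>" by (rule Q(1))
  note Bc = subringE(1)[OF B]
  have gc: "g \<in> carrier R" using g(1) Bc by blast
  let ?J = "{r \<in> B. \<exists>s\<in>B. r = d \<otimes> s}"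
  have "?J \<subseteq> Q"
  proof
    fix r assume "r \<in> ?J"
    then obtain s where s: "r \<in> B" "s \<in> B" "r = d \<otimes> s" by blast
    then have "g \<otimes> r = s \<otimes> (d \<otimes> g)" using d(1) gc Bc by (auto simp: m_ac)
    then have "g \<otimes> r \<in> Q" using Q.I_l_closed[OF Q(2), of s] s(2) by simp
    then show "r \<in> Q" using Q.I_prime[of g r] g s(1) by auto
  qed
  moreover have "?J \<subseteq> carrier (R\<lparr>carrier := B\<rparr>)" by auto
  moreover have "D ` ?J \<subseteq> ?J"
  proof
    fix y assume "y \<in> D ` ?J"
    then obtain s where s: "s \<in> B" "d \<otimes> s \<in> B" "y = D (d \<otimes> s)" by blast
    have Ds: "D s \<in> B" "D (d \<otimes> s) \<in> B" using dB.D_closed s(1,2) by auto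
    have "s \<in> carrier R" "D s \<in> carrier R" using s(1) Ds(1) Bc by auto
    then have "y = d \<otimes> D s" using s(3) dR.D_mult[OF d(1), of s] d by simp
    then show "y \<in> ?J" using Ds unfolding s(3) by blast
  qed
  ultimately have "?J \<subseteq> dB.differential_core Q" by (rule dB.differential_core_greatest)
  moreover have "d \<otimes> g \<in> ?J" using Q(2) Q.a_subset g(1) by auto
  ultimately have ne: "dB.differential_core Q \<noteq> {\<zero>}" using Q(3) by blast
  have core: "differential_prime_ideal (dB.differential_core Q) (R\<lparr>carrier := B\<rparr>) D"
    using dB.differential_core_prime[OF Q(1)] torsion_free by simp
  have "dB.differential_core Q = Q"
    using below[of "dB.differential_core Q"] core ne dB.differential_core_subset[of Q]
    unfolding differential_prime_ideal_def by blast
  then show ?thesis using core by simp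
qed

end

section \<open>Absence of new constants\<close>

theorem theorem1p2:
  fixes E :: "('a, 'm) ring_scheme" and F R :: "'a set" and D :: "'a \<Rightarrow> 'a" and xs :: "'a list"
  assumes "quotient_field_of E R"
    and "differential_ring E D"
    and "subfield F E"
    and "differential_ring (E\<lparr>carrier := F\<rparr>) D"
    and "char_zero (E\<lparr>carrier := F\<rparr>)"
    and "algebraically_closed (E\<lparr>carrier := constants (E\<lparr>carrier := F\<rparr>) D\<rparr>)"
    and "set xs \<subseteq> carrier E"
    and "R = ring.finite_extension E F xs"
    and "differential_ring (E\<lparr>carrier := R\<rparr>) D"
    and "finite {P. differential_prime_ideal P (E\<lparr>carrier := R\<rparr>) D \<and>
                    prime_height (E\<lparr>carrier := R\<rparr>) P = 1}"
  shows "constants E D = constants (E\<lparr>carrier := F\<rparr>) D"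
proof
  interpret E: field E using assms(1) unfolding quotient_field_of_def by blast
  interpret dE: differential_ring E D by (rule assms(2))
  let ?S = "E\<lparr>carrier := R\<rparr>"
  interpret dR: differential_ring ?S D by (rule assms(9))
  have R: "subring R E" using assms(1) unfolding quotient_field_of_def by blast
  interpret S: domain ?S by (rule E.subring_is_domain[OF R])
  note F = subfieldE(1)[OF assms(3)]
  note Fc = subringE(1)[OF F] and Rc = subringE(1)[OF R]
  have FR: "F \<subseteq> R" using E.finite_extension_incl[OF Fc assms(7)] assms(8) by simp
  have DF: "D ` F \<subseteq> F" using differential_ring.D_closed[OF assms(4)] by auto
  have const: "constants (E\<lparr>carrier := F\<rparr>) D = {a \<in> F. D a = \<zero>\<^bsub>E\<^esub>}" unfolding constants_def by simp
  show "constants (E\<lparr>carrier := F\<rparr>) D \<subseteq> constants E D" using Fc unfolding constants_def by auto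
  have frac: "carrier E \<subseteq> E.fractions R"
    using assms(1) unfolding quotient_field_of_def E.fractions_def by blast
  \<comment> \<open>The specializations \<open>\<alpha>\<close> are taken among the natural numbers, which are constants and, in
    characteristic zero, form an infinite set whose nonzero elements are units of \<open>F \<subseteq> R\<close>.\<close>
  define \<nu> where "\<nu> n = add_pow E (n::nat) \<one>\<^bsub>E\<^esub>" for n
  have \<nu>F: "\<nu> n \<in> F" for n
    unfolding \<nu>_def by (induct n) (use subringE[OF F] in auto)
  have \<nu>0: "\<nu> n \<noteq> \<zero>\<^bsub>E\<^esub>" if "n > 0" for n
  proof -
    have "add_pow (E\<lparr>carrier := F\<rparr>) k \<one>\<^bsub>E\<^esub> = \<nu> k" for k :: nat
      unfolding \<nu>_def by (induct k) (simp_all add: add_pow_def nat_pow_def)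
    then show ?thesis using assms(5) that unfolding char_zero_def by simp
  qed
  have \<nu>diff: "\<nu> m \<ominus>\<^bsub>E\<^esub> \<nu> n \<noteq> \<zero>\<^bsub>E\<^esub>" if "m < n" for m n
  proof
    assume "\<nu> m \<ominus>\<^bsub>E\<^esub> \<nu> n = \<zero>\<^bsub>E\<^esub>"
    moreover have "\<nu> n = \<nu> m \<oplus>\<^bsub>E\<^esub> \<nu> (n - m)"
      unfolding \<nu>_def using E.add.nat_pow_mult[of "\<one>\<^bsub>E\<^esub>" m "n - m"] that by simp
    moreover have "\<nu> m \<in> carrier E" "\<nu> n \<in> carrier E" "\<nu> (n - m) \<in> carrier E" using \<nu>F Fc by auto
    ultimately have "\<nu> (n - m) = \<zero>\<^bsub>E\<^esub>"
      by (metis E.add.l_cancel_one' E.r_right_minus_eq)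
    then show False using \<nu>0[of "n - m"] that by simp
  qed
  show "constants E D \<subseteq> constants (E\<lparr>carrier := F\<rparr>) D"
  proof (rule subsetI, rule ccontr)
    fix c assume "c \<in> constants E D" and new: "c \<notin> constants (E\<lparr>carrier := F\<rparr>) D"
    then have c: "c \<in> carrier E" "D c = \<zero>\<^bsub>E\<^esub>" unfolding constants_def by auto
    have trans: "(E.transcendental over F) c"
    proof (rule ccontr)
      assume "\<not> ?thesis"
      then have "(E.algebraic over F) c" by (simp add: over_def)
      from E.constant_algebraic_over_constants[OF assms(2,3) DF c this]
      have "c \<in> constants (E\<lparr>carrier := F\<rparr>) D"
        using E.algebraic_over_algebraically_closed[OF _ assms(6) c(1)] Fc unfolding const by blast
      then show False using new by blast
    qed
    obtain A where FA: "F \<subseteq> A" and M: "E.maximal_transcendental_subring R c A"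
      using E.exists_maximal_transcendental_subring[OF F FR c(1) trans] by blast
    note alg = E.algebraic_over_maximal_subring(1)[OF M c(1) R frac]
    have A: "subring A E" "A \<subseteq> R" "(E.transcendental over A) c"
      using M unfolding E.maximal_transcendental_subring_def by auto
    obtain f g where fg: "f \<in> R" "g \<in> R" "g \<noteq> \<zero>\<^bsub>E\<^esub>" "g \<otimes>\<^bsub>E\<^esub> c = f"
      using E.fractionsE[OF R] frac c(1) by (metis subsetD)
    have gcR: "g \<otimes>\<^bsub>E\<^esub> c \<in> R" using fg(1,4) by simp
    have gc: "g \<in> carrier E" using fg Rc by blast
    have RA: "R = E.finite_extension A xs"
    proof
      show "R \<subseteq> E.finite_extension A xs" using E.mono_finite_extension[OF FA] assms(8) by blast
      show "E.finite_extension A xs \<subseteq> R"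
        using E.finite_extension_subring_incl[OF R A(2)] E.finite_extension_mem[OF F assms(7)] assms(8) by blast
    qed
    obtain h where h: "h \<in> carrier (univ_poly E A)" "h \<noteq> []"
      and Qex: "\<And>\<alpha>. \<lbrakk>\<alpha> \<in> A; E.eval h \<alpha> \<noteq> \<zero>\<^bsub>E\<^esub>\<rbrakk> \<Longrightarrow>
        \<exists>Q. primeideal Q ?S \<and> (c \<ominus>\<^bsub>E\<^esub> \<alpha>) \<otimes>\<^bsub>E\<^esub> g \<in> Q \<and> g \<notin> Q \<and> Q \<inter> A \<subseteq> {\<zero>\<^bsub>E\<^esub>}"
      by (rule E.exists_prime_over_specialization[OF A(1) assms(7) RA frac c(1) A(3) alg fg(2,3) gcR])
        (rule that)
    define N where "N = {n. E.eval h (\<nu> n) \<noteq> \<zero>\<^bsub>E\<^esub>}"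
    have "\<forall>n\<in>N. \<exists>Q. primeideal Q ?S \<and> (c \<ominus>\<^bsub>E\<^esub> \<nu> n) \<otimes>\<^bsub>E\<^esub> g \<in> Q \<and> g \<notin> Q \<and> Q \<inter> A \<subseteq> {\<zero>\<^bsub>E\<^esub>}"
      using Qex \<nu>F FA unfolding N_def by blast
    from bchoice[OF this] obtain Q where Q: "\<forall>n\<in>N. primeideal (Q n) ?S \<and>
        (c \<ominus>\<^bsub>E\<^esub> \<nu> n) \<otimes>\<^bsub>E\<^esub> g \<in> Q n \<and> g \<notin> Q n \<and> Q n \<inter> A \<subseteq> {\<zero>\<^bsub>E\<^esub>}" ..
    have "differential_prime_ideal (Q n) ?S D \<and> prime_height ?S (Q n) = 1" if n: "n \<in> N" for n
    proof -
      have Qp: "primeideal (Q n) ?S" and Qe: "(c \<ominus>\<^bsub>E\<^esub> \<nu> n) \<otimes>\<^bsub>E\<^esub> g \<in> Q n" "g \<notin> Q n"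
        and QA: "Q n \<inter> A \<subseteq> {\<zero>\<^bsub>E\<^esub>}" using Q n by auto
      interpret Q: primeideal "Q n" ?S by (rule Qp)
      have iQ: "ideal (Q n) ?S" by (rule Q.is_ideal)
      have \<nu>: "\<nu> n \<in> carrier E" "\<nu> n \<in> F" using \<nu>F Fc by auto
      let ?d = "c \<ominus>\<^bsub>E\<^esub> \<nu> n"
      have d: "?d \<in> carrier E" "D ?d = \<zero>\<^bsub>E\<^esub>"
        using c \<nu>(1) dE.D_minus[OF c(1) \<nu>(1)] dE.D_add_pow_one[of n] unfolding \<nu>_def
        by (simp_all add: E.minus_eq)
      have "?d \<noteq> \<zero>\<^bsub>E\<^esub>"
      proof
        assume "?d = \<zero>\<^bsub>E\<^esub>"
        then have "c = \<nu> n" using c(1) \<nu>(1) by simp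
        then have "(E.algebraic over F) c" using E.algebraic_self[OF F] \<nu>(2) by simp
        then show False using trans by (simp add: over_def)
      qed
      then have nz: "?d \<otimes>\<^bsub>E\<^esub> g \<noteq> \<zero>\<^bsub>E\<^esub>" using E.integral_iff d(1) gc fg(3) by blast
      have below: "q = {\<zero>\<^bsub>E\<^esub>}" if "primeideal q ?S" "q \<subset> Q n" for q
        using E.prime_below_disjoint_ideal[OF M c(1) R frac iQ QA that] by blast
      have "prime_height ?S (Q n) = 1"
        using S.prime_height_one[OF Qp] below Qe(1) nz by auto
      moreover have "differential_prime_ideal (Q n) ?S D"
      proof (rule E.minimal_nonzero_prime_differential[OF assms(2,9) R d Qp Qe(1) nz fg(2) Qe(2)])
        show "q = {\<zero>\<^bsub>E\<^esub>}" if "primeideal q ?S" "q \<subset> Q n" for q using below[OF that] .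
      next
        fix k :: nat and x assume k: "k > 0" and x: "x \<in> R" and kx: "add_pow ?S k x \<in> Q n"
        have xE: "x \<in> carrier E" "\<nu> k \<in> carrier E" using x Rc \<nu>F Fc by auto
        have "add_pow ?S k x = add_pow E k x" by (simp add: add_pow_def nat_pow_def)
        also have "\<dots> = \<nu> k \<otimes>\<^bsub>E\<^esub> x" unfolding \<nu>_def using E.add_pow_ldistr[of "\<one>\<^bsub>E\<^esub>" x k] xE(1) by simp
        finally have eq: "add_pow ?S k x = \<nu> k \<otimes>\<^bsub>E\<^esub> x" .
        have i: "inv\<^bsub>E\<^esub> (\<nu> k) \<in> R" "inv\<^bsub>E\<^esub> (\<nu> k) \<otimes>\<^bsub>E\<^esub> \<nu> k = \<one>\<^bsub>E\<^esub>"
          using E.subfield_m_inv[OF assms(3), of "\<nu> k"] \<nu>F \<nu>0[OF k] FR by auto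
        have "inv\<^bsub>E\<^esub> (\<nu> k) \<otimes>\<^bsub>E\<^esub> (\<nu> k \<otimes>\<^bsub>E\<^esub> x) = x"
          using i xE Rc by (simp add: E.m_assoc[symmetric] subset_eq)
        then show "x \<in> Q n" using Q.I_l_closed[OF kx, of "inv\<^bsub>E\<^esub> (\<nu> k)"] i(1) eq by simp
      qed
      ultimately show ?thesis by blast
    qed
    then have "Q ` N \<subseteq> {P. differential_prime_ideal P ?S D \<and> prime_height ?S P = 1}" by blast
    then have fin: "finite (Q ` N)" using assms(10) finite_subset by blast
    have distinct: "Q m \<noteq> Q n" if mn: "m \<in> N" "n \<in> N" "m < n" for m n
    proof
      assume eq: "Q m = Q n"
      interpret Q: primeideal "Q n" ?S using Q mn(2) by blast
      have \<nu>: "\<nu> m \<in> carrier E" "\<nu> n \<in> carrier E" "\<nu> m \<in> F" "\<nu> n \<in> F" using \<nu>F Fc by auto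
      have e: "(c \<ominus>\<^bsub>E\<^esub> \<nu> m) \<otimes>\<^bsub>E\<^esub> g \<in> Q n" "(c \<ominus>\<^bsub>E\<^esub> \<nu> n) \<otimes>\<^bsub>E\<^esub> g \<in> Q n" "g \<notin> Q n"
        using Q mn(1,2) eq by auto
      let ?\<delta> = "\<nu> m \<ominus>\<^bsub>E\<^esub> \<nu> n"
      have \<delta>: "?\<delta> \<in> F - {\<zero>\<^bsub>E\<^esub>}" "?\<delta> \<in> carrier E" 
        using \<nu>diff[OF mn(3)] subringE(5,7)[OF F] \<nu> by (auto simp: E.minus_eq)
      have i: "inv\<^bsub>E\<^esub> ?\<delta> \<in> R" "inv\<^bsub>E\<^esub> ?\<delta> \<otimes>\<^bsub>E\<^esub> ?\<delta> = \<one>\<^bsub>E\<^esub>"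
        using E.subfield_m_inv[OF assms(3) \<delta>(1)] FR by auto
      have m1: "\<ominus>\<^bsub>E\<^esub> \<one>\<^bsub>E\<^esub> \<in> R" using subringE(3,5)[OF R] by blast
      have "\<ominus>\<^bsub>E\<^esub> \<one>\<^bsub>E\<^esub> \<otimes>\<^bsub>E\<^esub> ((c \<ominus>\<^bsub>E\<^esub> \<nu> m) \<otimes>\<^bsub>E\<^esub> g) \<in> Q n" using Q.I_l_closed[OF e(1)] m1 by simp
      then have "\<ominus>\<^bsub>E\<^esub> \<one>\<^bsub>E\<^esub> \<otimes>\<^bsub>E\<^esub> ((c \<ominus>\<^bsub>E\<^esub> \<nu> m) \<otimes>\<^bsub>E\<^esub> g) \<oplus>\<^bsub>E\<^esub> (c \<ominus>\<^bsub>E\<^esub> \<nu> n) \<otimes>\<^bsub>E\<^esub> g \<in> Q n"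
        using Q.a_closed e(2) by simp
      moreover have "\<ominus>\<^bsub>E\<^esub> \<one>\<^bsub>E\<^esub> \<otimes>\<^bsub>E\<^esub> ((c \<ominus>\<^bsub>E\<^esub> \<nu> m) \<otimes>\<^bsub>E\<^esub> g) \<oplus>\<^bsub>E\<^esub> (c \<ominus>\<^bsub>E\<^esub> \<nu> n) \<otimes>\<^bsub>E\<^esub> g = ?\<delta> \<otimes>\<^bsub>E\<^esub> g"
        using c(1) \<nu>(1,2) gc by algebra
      ultimately have "inv\<^bsub>E\<^esub> ?\<delta> \<otimes>\<^bsub>E\<^esub> (?\<delta> \<otimes>\<^bsub>E\<^esub> g) \<in> Q n" using Q.I_l_closed i(1) by simp
      then have "g \<in> Q n" using i \<delta>(2) gc Rc by (simp add: E.m_assoc[symmetric] subset_eq)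
      then show False using e(3) by blast
    qed
    then have "inj_on Q N" by (rule linorder_inj_onI')
    then have "finite N" using fin finite_image_iff by blast
    moreover have "finite (- N)"
    proof -
      have hc: "h \<in> carrier (univ_poly E (carrier E))"
        using E.carrier_polynomial[OF A(1)] h(1) unfolding univ_poly_carrier[symmetric] by blast
      have "\<nu> ` (- N) \<subseteq> {x. E.is_root h x}"
        using \<nu>F Fc h(2) unfolding N_def E.is_root_def by auto
      then have "finite (\<nu> ` (- N))" using E.finite_number_of_roots[OF hc] finite_subset by blast
      moreover have "inj \<nu>"
      proof (rule linorder_injI)
        fix m n :: nat assume "m < n"
        have "\<nu> n \<in> carrier E" using \<nu>F Fc by blast
        then show "\<nu> m \<noteq> \<nu> n" using \<nu>diff[OF \<open>m < n\<close>] by auto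
      qed
      ultimately show ?thesis using finite_imageD[OF _ inj_on_subset[OF _ subset_UNIV]] by blast
    qed
    ultimately show False using infinite_UNIV_nat by (metis Compl_partition finite_Un)
  qed
qed

end
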